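(* Let $k$ be a field of characteristic different from $2$ and let $q\in k[T]$ be a monic reciprocal polynomial of degree $d\geq 1$. Write $$q(T)=(T-1)^{v_+}(T+1)^{v_-}\mathcal Q_0(T),\qquad \mathcal Q_0\in k[T],\quad \mathcal Q_0(\pm1)\neq 0.$$ (i) If $v_->0$, then, for any prescribed class in $k^\star/(k^\star)^2$, there exists a non-degenerate symmetric bilinear space over $k$ of dimension $d$ with an isometry $\gamma$ of characteristic polynomial $q$ and with spinor norm $\mathrm{N}_{\rm spin}(\gamma)$ equal to that class. In particular, this is true if $d$ is odd. (ii) If $v_-=0$ and $\gamma$ is an isometry of a non-degenerate quadratic space over $k$ with characteristic polynomial $q$, then its spinor norm equals $\mathcal Q_0(-1)$ in $k^\star/(k^\star)^2$. In particular, this is the case if $q$ is separable and $d$ is even.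
   Context: A polynomial $q\in k[T]$ is reciprocal if $T^{\deg q}q(1/T)=q(T)$. A quadratic space over $k$ is a finite dimensional $k$-vector space $V$ with a symmetric bilinear form $\Psi$. Spinor norm: let $(V,\Psi)$ be a non-degenerate finite dimensional quadratic space. For a non-isotropic vector $v\in V$ let $r_v$ be the reflection with respect to the hyperplane $v^\perp$. Any isometry of $V$ is a product $\prod_v r_v$ over a finite family of non-isotropic vectors, and $\prod_v r_v\mapsto\prod_v\Psi(v,v)$ is a well-defined group homomorphism $\mathrm{N}_{\rm spin}\colon O(V,\Psi)\to k^\star/(k^\star)^2$, called the spinor norm (note the normalization $\mathrm{N}_{\rm spin}(r_v)=\Psi(v,v)$). *)

theory Defs
  imports "Jordan_Normal_Form.Char_Poly" "HOL-Library.Function_Algebras"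
begin

definition reciprocal :: "'k::field poly \<Rightarrow> bool" where
  \<comment> \<open>\<^const>\<open>reflect_poly\<close> sends \<open>q\<close> to \<open>T^(deg q) * q(1/T)\<close>\<close>
  "reciprocal q \<longleftrightarrow> reflect_poly q = q"

definition separable_poly :: "'k::field poly \<Rightarrow> bool" where
  "separable_poly q \<longleftrightarrow> coprime q (pderiv q)"

text \<open>Elements of the group of units of \<open>k\<close> modulo squares, as cosets.\<close>

definition square_class :: "'k::field \<Rightarrow> 'k set" where
  "square_class a = {a * s\<^sup>2 | s. s \<noteq> 0}"

definition square_classes :: "'k::field set set" where
  "square_classes = square_class ` {a. a \<noteq> 0}"

text \<open>
  The space is a finite-dimensional subspace \<open>V\<close> of an ambient vector space
  (so that its dimension is not tied to a type); forms and maps only matter on \<open>V\<close>.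
\<close>

locale quadratic_space = vector_space scale
  for scale :: "'k::field \<Rightarrow> 'v::ab_group_add \<Rightarrow> 'v" (infixr "*s" 75) +
  fixes V :: "'v set" and \<Psi> :: "'v \<Rightarrow> 'v \<Rightarrow> 'k"
  assumes subspace_V: "subspace V"
    and finite_dim_V: "\<exists>B. finite B \<and> V = span B"
    and form_add: "\<lbrakk>x \<in> V; y \<in> V; z \<in> V\<rbrakk> \<Longrightarrow> \<Psi> (x + y) z = \<Psi> x z + \<Psi> y z"
    and form_scale: "\<lbrakk>x \<in> V; y \<in> V\<rbrakk> \<Longrightarrow> \<Psi> (c *s x) y = c * \<Psi> x y"
    and form_sym: "\<lbrakk>x \<in> V; y \<in> V\<rbrakk> \<Longrightarrow> \<Psi> x y = \<Psi> y x"
begin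

definition isometry :: "('v \<Rightarrow> 'v) \<Rightarrow> bool" where
  "isometry f \<longleftrightarrow> bij_betw f V V
     \<and> (\<forall>x\<in>V. \<forall>y\<in>V. f (x + y) = f x + f y)
     \<and> (\<forall>c. \<forall>x\<in>V. f (c *s x) = c *s f x)
     \<and> (\<forall>x\<in>V. \<forall>y\<in>V. \<Psi> (f x) (f y) = \<Psi> x y)"

definition ordered_basis :: "'v list \<Rightarrow> bool" where
  "ordered_basis bs \<longleftrightarrow> distinct bs \<and> independent (set bs) \<and> span (set bs) = V"

definition matrix_wrt :: "'v list \<Rightarrow> ('v \<Rightarrow> 'v) \<Rightarrow> 'k mat" where
  "matrix_wrt bs f = mat (length bs) (length bs)
     (\<lambda>(i, j). representation (set bs) (f (bs ! j)) (bs ! i))"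

text \<open>Independent of the choice of the basis for an endomorphism of \<open>V\<close>.\<close>

definition characteristic_poly :: "('v \<Rightarrow> 'v) \<Rightarrow> 'k poly" where
  "characteristic_poly f = char_poly (matrix_wrt (SOME bs. ordered_basis bs) f)"

definition reflection :: "'v \<Rightarrow> 'v \<Rightarrow> 'v" where
  "reflection v x = x - (2 * \<Psi> x v / \<Psi> v v) *s v"

text \<open>
  \<open>vs\<close> lists the vectors of a factorization of \<open>f\<close> (on \<open>V\<close>) into reflections;
  the empty list gives the identity.
\<close>

definition reflection_factorization :: "('v \<Rightarrow> 'v) \<Rightarrow> 'v list \<Rightarrow> bool" where
  "reflection_factorization f vs \<longleftrightarrow>
     (\<forall>v\<in>set vs. v \<in> V \<and> \<Psi> v v \<noteq> 0)
     \<and> (\<forall>x\<in>V. f x = foldr (\<lambda>v g. reflection v \<circ> g) vs id x)"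

text \<open>
  For an isometry of a non-degenerate space in characteristic different from 2, a
  factorization exists and the resulting class does not depend on it; the class is
  normalized by \<open>\<Psi> v v\<close> (and not \<open>\<Psi> v v / 2\<close>) for the reflection in \<open>v\<close>.
\<close>

definition spinor_norm :: "('v \<Rightarrow> 'v) \<Rightarrow> 'k set" where
  "spinor_norm f = (THE C. \<exists>vs. reflection_factorization f vs
     \<and> C = square_class (\<Prod>v\<leftarrow>vs. \<Psi> v v))"

end

locale nondegenerate_quadratic_space = quadratic_space +
  assumes nondegenerate: "\<lbrakk>x \<in> V; \<And>y. y \<in> V \<Longrightarrow> \<Psi> x y = 0\<rbrakk> \<Longrightarrow> x = 0"

text \<open>
  Sequences over \<open>k\<close> as an ambient space: it contains a copy of every
  finite-dimensional vector space over \<open>k\<close>.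
\<close>

definition seq_scale :: "'k::field \<Rightarrow> (nat \<Rightarrow> 'k) \<Rightarrow> nat \<Rightarrow> 'k" where
  "seq_scale c f = (\<lambda>i. c * f i)"

lemma vector_space_seq_scale: "vector_space seq_scale"
  by unfold_locales (auto simp: seq_scale_def fun_eq_iff algebra_simps)

end

theory Submission
  imports Defs "HOL-Computational_Algebra.Formal_Power_Series"
begin

text \<open>
  Both parts rest on one determinant formula. Let \<open>\<gamma>\<close> be the product of the reflections in
  \<open>v\<^sub>1, \<dots>, v\<^sub>m\<close> on a space of dimension \<open>n\<close>. Let \<open>S\<close> be the Gram matrix of the \<open>v\<^sub>i\<close>, and let
  \<open>M\<close> be the upper triangular matrix with \<open>M + M\<^sup>T = S\<close>, so that \<open>2^m det M\<close> is the product of the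
  \<open>\<Psi> v\<^sub>i v\<^sub>i\<close>. Following a vector through the reflections one after the other gives
  \<open>\<gamma> = 1 - U M\<inverse> W\<close>, where the columns of \<open>U\<close> are the coordinates of the \<open>v\<^sub>i\<close>, the rows of \<open>W\<close> are
  the linear forms \<open>\<Psi> _ v\<^sub>i\<close>, and \<open>W U = S\<close>. Since \<open>det (1 - U X) = det (1 - X U)\<close>,
  \<open>det M \<cdot> det (1 + \<gamma>) = 2^n det (M - S/2)\<close>. The matrix \<open>M - S/2\<close> is alternating, hence its
  determinant is a square, and it vanishes if \<open>m\<close> is odd (\<open>spinor_determinant_formula\<close>).

  For \<open>\<gamma> = 1\<close> the formula says that the product of the \<open>\<Psi> v\<^sub>i v\<^sub>i\<close> is a square; together with the
  theorem of Cartan and Dieudonne (\<open>Cartan_Dieudonne\<close>), which provides a factorization, this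
  makes the spinor norm a well-defined class. For an isometry without the eigenvalue \<open>-1\<close> the
  formula computes the spinor norm as the class of \<open>2^n det (1 + \<gamma>)\<close>, which for even \<open>n\<close> is the
  class of the value of the characteristic polynomial at \<open>-1\<close>. A reciprocal \<open>q\<close> forces the exponent
  of \<open>T - 1\<close> and the degree of the cofactor \<open>Q\<^sub>0\<close> to be even, so for \<open>v\<^sub>- = 0\<close> the value at \<open>-1\<close> is
  \<open>(-2)^(v\<^sub>+) Q\<^sub>0(-1)\<close>, which is in the class of \<open>Q\<^sub>0(-1)\<close>.

  For \<open>v\<^sub>- > 0\<close>, take any non-degenerate space with an isometry of characteristic
  polynomial \<open>q / (T + 1)\<close> and add an orthogonal line, spanned by a vector of norm \<open>a\<close>, on which the
  isometry is \<open>-1\<close>. This multiplies the spinor norm by \<open>a\<close>, which is arbitrary. The space for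
  \<open>q / (T + 1)\<close> is an orthogonal sum of lines with isometry \<open>1\<close> or \<open>-1\<close> and a space for \<open>Q\<^sub>0\<close>. The
  companion matrix \<open>G\<close> of \<open>Q\<^sub>0\<close> preserves a non-degenerate alternating Toeplitz form \<open>J\<close>, read off
  from the power series \<open>T^n / Q\<^sub>0\<close> (with \<open>2 n\<close> the degree), and then preserves the symmetric form
  \<open>J (G - G\<inverse>)\<close>, which is non-degenerate because \<open>Q\<^sub>0(1)\<close> and \<open>Q\<^sub>0(-1)\<close> do not vanish.
\<close>

section \<open>Determinants\<close>

text \<open>
  Block elimination: \<open>X\<close> times the upper block row is added to the lower one.
\<close>

lemma det_four_block_clear_lower_left:
  fixes P :: "'a::field mat"
  assumes P: "P \<in> carrier_mat m m" and B: "B \<in> carrier_mat m n"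
    and C: "C \<in> carrier_mat n m" and D: "D \<in> carrier_mat n n"
    and X: "X \<in> carrier_mat n m" and clear: "X * P + C = 0\<^sub>m n m"
  shows "det (four_block_mat P B C D) = det P * det (X * B + D)"
proof -
  let ?E = "four_block_mat (1\<^sub>m m) (0\<^sub>m m n) X (1\<^sub>m n)"
  have E: "?E \<in> carrier_mat (m + n) (m + n)" using X by auto
  have K: "four_block_mat P B C D \<in> carrier_mat (m + n) (m + n)" using P D by auto
  have "?E * four_block_mat P B C D = four_block_mat P B (0\<^sub>m n m) (X * B + D)"
    using P B C D X clear
    by (subst mult_four_block_mat[where ?nr1.0 = m and ?n1.0 = m and ?n2.0 = n and ?nr2.0 = n
          and ?nc1.0 = m and ?nc2.0 = n]) auto
  moreover have "det ?E = 1"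
    using X by (subst det_four_block_mat_upper_right_zero[where n = m and m = n]) auto
  ultimately have "det (four_block_mat P B C D)
      = det (four_block_mat P B (0\<^sub>m n m) (X * B + D))"
    using det_mult[OF E K] by simp
  also have "\<dots> = det P * det (X * B + D)"
    using P B D X by (intro det_four_block_mat_lower_left_zero) auto
  finally show ?thesis .
qed

text \<open>
  Both sides are the determinant of the matrix with blocks \<open>1, C, U, 1\<close>, computed by
  clearing its lower left block with row operations and with column operations.
\<close>

lemma det_one_minus_mult_commute:
  fixes U :: "'a::field mat"
  assumes U: "U \<in> carrier_mat n m" and C: "C \<in> carrier_mat m n"
  shows "det (1\<^sub>m n - U * C) = det (1\<^sub>m m - C * U)"
proof -
  let ?F = "four_block_mat (1\<^sub>m m) C U (1\<^sub>m n)"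
  have 1: "det ?F = det (1\<^sub>m n - U * C)"
  proof -
    have e: "- U * C + 1\<^sub>m n = 1\<^sub>m n - U * C"
      using U C by (intro eq_matI) auto
    have "det ?F = det (1\<^sub>m m :: 'a mat) * det (- U * C + 1\<^sub>m n)"
      using U C by (intro det_four_block_clear_lower_left) auto
    then show ?thesis by (simp only: e det_one mult_1)
  qed
  let ?H = "four_block_mat (1\<^sub>m m) (0\<^sub>m m n) (- U) (1\<^sub>m n)"
  have "?F * ?H = four_block_mat (1\<^sub>m m - C * U) C (0\<^sub>m n m) (1\<^sub>m n)"
  proof -
    have e: "1\<^sub>m m + C * (- U) = 1\<^sub>m m - C * U"
      using U C by (intro eq_matI) auto
    show ?thesis
      using U C e
      by (subst mult_four_block_mat[where ?nr1.0 = m and ?n1.0 = m and ?n2.0 = n and ?nr2.0 = n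
            and ?nc1.0 = m and ?nc2.0 = n]) auto
  qed
  moreover have "det ?H = 1"
    using U by (subst det_four_block_mat_upper_right_zero[where n = m and m = n]) auto
  moreover have "det (?F * ?H) = det ?F * det ?H"
    using U C by (intro det_mult[of _ "m + n"]) auto
  moreover have "det (four_block_mat (1\<^sub>m m - C * U) C (0\<^sub>m n m) (1\<^sub>m n)) = det (1\<^sub>m m - C * U)"
    using U C by (subst det_four_block_mat_lower_left_zero[where n = m and m = n]) auto
  ultimately show ?thesis using 1 by simp
qed

text \<open>
  The zero diagonal is a separate condition: in characteristic 2 it does not follow from
  skew symmetry, and the determinant is a square in every characteristic.
\<close>

definition alternating_mat :: "'a::ab_group_add mat \<Rightarrow> bool" where
  "alternating_mat K \<longleftrightarrow> square_mat K \<and> (\<forall>i<dim_row K. K $$ (i,i) = 0)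
     \<and> (\<forall>i<dim_row K. \<forall>j<dim_row K. K $$ (j,i) = - K $$ (i,j))"

lemma alternating_matD:
  assumes "alternating_mat K" and "K \<in> carrier_mat m m"
  shows "i < m \<Longrightarrow> K $$ (i,i) = 0"
    and "i < m \<Longrightarrow> j < m \<Longrightarrow> K $$ (j,i) = - K $$ (i,j)"
  using assms unfolding alternating_mat_def carrier_mat_def by blast+

lemma alternating_matI:
  assumes "K \<in> carrier_mat m m" and "\<And>i. i < m \<Longrightarrow> K $$ (i,i) = 0"
    and "\<And>i j. i < m \<Longrightarrow> j < m \<Longrightarrow> K $$ (j,i) = - K $$ (i,j)"
  shows "alternating_mat K"
  using assms unfolding alternating_mat_def carrier_mat_def square_mat.simps by blast

text \<open>
  A nonzero entry of the first row can be moved to position \<open>(0,1)\<close> by a simultaneous permutation of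
  rows and columns. It then spans with its mirror image an invertible \<open>2 \<times> 2\<close> block of
  determinant \<open>p\<^sup>2\<close>, whose Schur complement is again alternating. The root of the
  determinant found in this way is the Pfaffian.
\<close>

lemma det_alternating_is_square:
  fixes K :: "'a::field mat"
  assumes "alternating_mat K"
  shows "\<exists>s. det K = s\<^sup>2"
proof -
  have "\<exists>s. det K = s\<^sup>2" if "K \<in> carrier_mat m m" "alternating_mat K" for m and K :: "'a mat"
    using that
  proof (induction m arbitrary: K rule: less_induct)
    case (less m)
    have pivot: "\<exists>s. det L = s\<^sup>2"
      if L: "L \<in> carrier_mat m m" and alt: "alternating_mat L" and m: "2 \<le> m"
        and p: "L $$ (0,1) \<noteq> 0" for L :: "'a mat"
    proof -
      define n where "n = m - 2"
      have mn: "m = 2 + n" using m by (simp add: n_def)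
      define p where "p = L $$ (0,1)"
      have asym: "L $$ (j,i) = - L $$ (i,j)" if "i < m" "j < m" for i j
        using alternating_matD[OF alt L] that by blast
      have diag: "L $$ (i,i) = 0" if "i < m" for i
        using alternating_matD[OF alt L] that by blast
      define P where "P = mat 2 2 (\<lambda>(i,j). L $$ (i,j))"
      define B where "B = mat 2 n (\<lambda>(i,j). L $$ (i,j+2))"
      define C where "C = mat n 2 (\<lambda>(i,j). L $$ (i+2,j))"
      define D where "D = mat n n (\<lambda>(i,j). L $$ (i+2,j+2))"
      \<comment> \<open>\<open>X = - C P\<inverse>\<close>, as \<open>P\<close> has zero diagonal and off-diagonal entries \<open>p\<close>, \<open>- p\<close>\<close>
      define X where "X = mat n 2 (\<lambda>(i,j). if j = 0 then - L $$ (i+2,1) / p else L $$ (i+2,0) / p)"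
      note car = P_def B_def C_def D_def X_def
      have c: "P \<in> carrier_mat 2 2" "B \<in> carrier_mat 2 n" "C \<in> carrier_mat n 2"
        "D \<in> carrier_mat n n" "X \<in> carrier_mat n 2" by (auto simp: car)
      have L_eq: "L = four_block_mat P B C D"
      proof (rule eq_matI)
        have sub: "i - 2 + 2 = i" if "\<not> i < 2" for i :: nat using that by simp
        fix i j assume "i < dim_row (four_block_mat P B C D)" "j < dim_col (four_block_mat P B C D)"
        then show "L $$ (i,j) = four_block_mat P B C D $$ (i,j)"
          by (cases "i < 2"; cases "j < 2") (simp_all add: car sub del: add_2_eq_Suc')
      qed (use L mn in \<open>auto simp: car\<close>)
      have p0: "p \<noteq> 0" using p by (simp add: p_def)
      have L10: "L $$ (Suc 0, 0) = - p" "L $$ (0, Suc 0) = p" "L $$ (0,0) = 0"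
        "L $$ (Suc 0, Suc 0) = 0"
        using asym[of 0 1] diag[of 0] diag[of 1] m by (auto simp: p_def)
      have "X * P + C = 0\<^sub>m n 2"
      proof (intro eq_matI)
        fix i j assume "i < dim_row (0\<^sub>m n 2 :: 'a mat)" "j < dim_col (0\<^sub>m n 2 :: 'a mat)"
        then have ij: "i < n" "j = 0 \<or> j = 1" by auto
        then show "(X * P + C) $$ (i,j) = 0\<^sub>m n 2 $$ (i,j)"
          using p0 L10 by (auto simp: car scalar_prod_def numeral_2_eq_2)
      qed (auto simp: car)
      then have "det L = det P * det (X * B + D)"
        unfolding L_eq using c by (intro det_four_block_clear_lower_left)
      moreover have "det P = p\<^sup>2"
      proof -
        have "det (mat_delete P 0 1) = - p"
          using L10 by (subst det_single) (auto simp: mat_delete_def car)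
        then show ?thesis
          using L10 laplace_expansion_row[OF c(1), of 0]
          by (simp add: numeral_2_eq_2 cofactor_def car power2_eq_square)
      qed
      moreover have "\<exists>s. det (X * B + D) = s\<^sup>2"
      proof (rule less.IH[of n])
        show "n < m" using mn by simp
        show "X * B + D \<in> carrier_mat n n" using c by auto
        have ent: "(X * B + D) $$ (i,j) = L $$ (i+2,j+2)
            + (L $$ (i+2,0) * L $$ (1,j+2) - L $$ (i+2,1) * L $$ (0,j+2)) / p"
          if "i < n" "j < n" for i j
          using that by (auto simp: car scalar_prod_def numeral_2_eq_2 diff_divide_distrib)
        show "alternating_mat (X * B + D)"
        proof (rule alternating_matI)
          show "X * B + D \<in> carrier_mat n n" using c by auto
        next
          fix i assume i: "i < n"
          show "(X * B + D) $$ (i,i) = 0"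
            unfolding ent[OF i i] using i mn asym[of 0 "i+2"] asym[of 1 "i+2"] diag[of "i+2"] by simp
        next
          fix i j assume i: "i < n" and j: "j < n"
          have r: "L $$ (j+2,i+2) = - L $$ (i+2,j+2)" "L $$ (j+2,0) = - L $$ (0,j+2)"
            "L $$ (j+2,1) = - L $$ (1,j+2)" "L $$ (1,i+2) = - L $$ (i+2,1)"
            "L $$ (0,i+2) = - L $$ (i+2,0)"
            by (rule asym; use i j mn in linarith)+
          show "(X * B + D) $$ (j,i) = - (X * B + D) $$ (i,j)"
            unfolding ent[OF i j] ent[OF j i] r by (simp add: algebra_simps diff_divide_distrib add_divide_distrib)
        qed
      qed
      ultimately show ?thesis by (metis power_mult_distrib)
    qed
    show ?case
    proof (cases "m = 0")
      case True
      then have "det K = 1\<^sup>2" using less.prems(1) by (simp add: det_dim_zero)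
      then show ?thesis by blast
    next
      case False
      note K = less.prems(1)
      note altD = alternating_matD[OF less.prems(2) K]
      show ?thesis
      proof (cases "\<forall>j<m. K $$ (0,j) = 0")
        case True
        then have "det K = 0\<^sup>2"
          using laplace_expansion_row[OF K, of 0] False by simp
        then show ?thesis by blast
      next
        case False
        then obtain j where j: "j < m" "K $$ (0,j) \<noteq> 0" by blast
        have j0: "0 < j" using j altD(1)[of 0] by (cases j) auto
        \<comment> \<open>move column \<open>j\<close>, where the first row is nonzero, to column 1, and row \<open>j\<close> to row 1\<close>
        define \<sigma> where "\<sigma> = Transposition.transpose (1::nat) j"
        have perm: "\<sigma> permutes {0..<m}"
          unfolding \<sigma>_def using j j0 by (intro permutes_swap_id) auto
        have lt: "\<sigma> i < m" if "i < m" for i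
          using permutes_in_image[OF perm, of i] that by simp
        define K1 where "K1 = mat m m (\<lambda>(i,l). K $$ (\<sigma> i, l))"
        define K2 where "K2 = mat m m (\<lambda>(i,l). K1\<^sup>T $$ (\<sigma> i, l))"
        have ent: "K2 $$ (i,l) = K $$ (\<sigma> l, \<sigma> i)" if "i < m" "l < m" for i l
          using that lt by (simp add: K1_def K2_def)
        have K2: "K2 \<in> carrier_mat m m" by (simp add: K2_def)
        have "det K1 = signof \<sigma> * det K"
          unfolding K1_def by (rule det_permute_rows[OF K perm])
        moreover have "det K2 = signof \<sigma> * det (K1\<^sup>T)"
          unfolding K2_def by (rule det_permute_rows[OF _ perm]) (simp add: K1_def)
        moreover have "det (K1\<^sup>T) = det K1"
          by (rule det_transpose[of _ m]) (simp add: K1_def)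
        ultimately have "det K2 = det K"
          by (auto simp: sign_def)
        moreover have "\<exists>s. det K2 = s\<^sup>2"
        proof (rule pivot[OF K2])
          show "alternating_mat K2"
          proof (rule alternating_matI[OF K2])
            show "K2 $$ (i,i) = 0" if "i < m" for i
              using that by (simp only: ent altD(1) lt)
            show "K2 $$ (l,i) = - K2 $$ (i,l)" if "i < m" "l < m" for i l
              unfolding ent[OF that] ent[OF that(2,1)] by (rule altD(2)) (use that lt in auto)
          qed
          show "2 \<le> m" using j j0 by simp
          have "K $$ (j,0) = - K $$ (0,j)"
            using j by (intro altD(2)) auto
          then show "K2 $$ (0,1) \<noteq> 0" using j j0
            by (subst ent) (auto simp: \<sigma>_def Transposition.transpose_def)
        qed
        ultimately show ?thesis by simp
      qed
    qed
  qed
  then show ?thesis using assms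
    unfolding alternating_mat_def by (metis carrier_matI square_mat.simps)
qed

lemma even_if_neg_one_power_eq_one:
  assumes two: "(2::'a::field) \<noteq> 0" and "(- 1 :: 'a) ^ m = 1"
  shows "even m"
proof -
  have "(- 1 :: 'a) \<noteq> 1"
    using two by (metis add_eq_0_iff one_add_one)
  then show ?thesis
    using assms(2) by (metis neg_one_odd_power)
qed

lemma alternating_dim_even:
  fixes K :: "'a::field mat"
  assumes alt: "alternating_mat K" and K: "K \<in> carrier_mat m m" and det0: "det K \<noteq> 0" and two: "(2::'a) \<noteq> 0"
  shows "even m"
proof -
  have "K\<^sup>T = (- 1) \<cdot>\<^sub>m K"
  proof (rule eq_matI)
    fix i j assume "i < dim_row ((- 1) \<cdot>\<^sub>m K)" "j < dim_col ((- 1) \<cdot>\<^sub>m K)"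
    then have ij: "i < m" "j < m" using K by auto
    then have "K\<^sup>T $$ (i,j) = K $$ (j,i)" using K by simp
    also have "\<dots> = - K $$ (i,j)" by (rule alternating_matD(2)[OF alt K ij])
    finally show "K\<^sup>T $$ (i,j) = ((- 1) \<cdot>\<^sub>m K) $$ (i,j)" using K ij by simp
  qed (use K in auto)
  then have "det K = (- 1) ^ m * det K"
    using det_transpose[OF K] K by simp
  then have "(- 1 :: 'a) ^ m = 1" using det0 by simp
  then show ?thesis by (rule even_if_neg_one_power_eq_one[OF two])
qed

section \<open>Square classes and the spinor norm as a determinant\<close>

lemma square_class_eqI:
  fixes a b s :: "'k::field"
  assumes "a = b * s\<^sup>2" and "s \<noteq> 0"
  shows "square_class a = square_class b"
proof -
  have sub: "square_class a \<subseteq> square_class b" if "a = b * s\<^sup>2" "s \<noteq> 0" for a b s :: 'k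
  proof
    fix x assume "x \<in> square_class a"
    then obtain r where "r \<noteq> 0" "x = a * r\<^sup>2" unfolding square_class_def by blast
    then have "s * r \<noteq> 0" "x = b * (s * r)\<^sup>2" using that by (simp_all add: power_mult_distrib)
    then show "x \<in> square_class b" unfolding square_class_def by blast
  qed
  have "b = a * (1 / s)\<^sup>2" using assms by (simp add: power_divide)
  then show ?thesis using sub[OF assms] sub[of b a "1 / s"] assms(2) by auto
qed

text \<open>
  Modulo squares every unit is its own inverse.
\<close>

lemma square_class_mult_square_eqI:
  fixes a b s :: "'k::field"
  assumes "a * b = s\<^sup>2" and "s \<noteq> 0"
  shows "square_class a = square_class b"
proof -
  have "b \<noteq> 0" using assms by auto
  then have "a = b * (s / b)\<^sup>2"
    using assms(1) by (simp add: power_divide power2_eq_square[of b] flip: assms(1))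
  then show ?thesis by (rule square_class_eqI) (use assms(2) \<open>b \<noteq> 0\<close> in auto)
qed

context quadratic_space
begin

lemma zero_in_V: "0 \<in> V"
  using subspace_V by (rule subspace_0)

lemma add_in_V: "x \<in> V \<Longrightarrow> y \<in> V \<Longrightarrow> x + y \<in> V"
  using subspace_V by (rule subspace_add)

lemma diff_in_V: "x \<in> V \<Longrightarrow> y \<in> V \<Longrightarrow> x - y \<in> V"
  using subspace_V by (rule subspace_diff)

lemma scale_in_V: "x \<in> V \<Longrightarrow> c *s x \<in> V"
  using subspace_V by (rule subspace_scale)

lemma sum_in_V: "(\<And>i. i \<in> I \<Longrightarrow> x i \<in> V) \<Longrightarrow> (\<Sum>i\<in>I. x i) \<in> V"
  using subspace_V by (rule subspace_sum)

lemma form_zero_left: "z \<in> V \<Longrightarrow> \<Psi> 0 z = 0"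
  using form_scale[of 0 z 0] zero_in_V by simp

lemma form_diff: "x \<in> V \<Longrightarrow> y \<in> V \<Longrightarrow> z \<in> V \<Longrightarrow> \<Psi> (x - y) z = \<Psi> x z - \<Psi> y z"
  using form_add[of "x - y" y z] diff_in_V by simp

lemma form_add_right: "x \<in> V \<Longrightarrow> y \<in> V \<Longrightarrow> z \<in> V \<Longrightarrow> \<Psi> z (x + y) = \<Psi> z x + \<Psi> z y"
  by (metis form_add form_sym add_in_V)

lemma form_diff_right: "x \<in> V \<Longrightarrow> y \<in> V \<Longrightarrow> z \<in> V \<Longrightarrow> \<Psi> z (x - y) = \<Psi> z x - \<Psi> z y"
  by (metis form_diff form_sym diff_in_V)

lemma form_scale_right: "x \<in> V \<Longrightarrow> y \<in> V \<Longrightarrow> \<Psi> x (c *s y) = c * \<Psi> x y"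
  by (metis form_scale form_sym scale_in_V)

lemma form_sum:
  assumes "z \<in> V" and "\<And>i. i \<in> I \<Longrightarrow> x i \<in> V"
  shows "\<Psi> (\<Sum>i\<in>I. c i *s x i) z = (\<Sum>i\<in>I. c i * \<Psi> (x i) z)"
  using assms(2)
proof (induction I rule: infinite_finite_induct)
  case (insert i I)
  then show ?case
    using assms(1) by (simp add: form_add form_scale sum_in_V scale_in_V)
qed (simp_all add: form_zero_left assms(1))

lemma ordered_basis_exists: "\<exists>bs. ordered_basis bs"
proof -
  obtain B where B: "finite B" "V = span B" using finite_dim_V by blast
  obtain C where C: "C \<subseteq> V" "independent C" "V \<subseteq> span C"
    using maximal_independent_subset by blast
  have "finite C" using independent_span_bound[OF B(1) C(2)] C(1) B(2) by simp
  then obtain bs where "set bs = C" "distinct bs" using finite_distinct_list by blast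
  then show ?thesis
    using C span_minimal[OF C(1) subspace_V] unfolding ordered_basis_def by blast
qed

lemma ordered_basis_in_V: "ordered_basis bs \<Longrightarrow> i < length bs \<Longrightarrow> bs ! i \<in> V"
  unfolding ordered_basis_def by (metis nth_mem span_base)

lemma basis_expansion:
  assumes bs: "ordered_basis bs" and x: "x \<in> V"
  shows "x = (\<Sum>i<length bs. representation (set bs) x (bs ! i) *s bs ! i)"
proof -
  have "x = (\<Sum>b\<in>set bs. representation (set bs) x b *s b)"
    using bs x unfolding ordered_basis_def
    by (intro sum_representation_eq[symmetric]) auto
  also have "\<dots> = (\<Sum>i<length bs. representation (set bs) x (bs ! i) *s bs ! i)"
    using bs unfolding ordered_basis_def
    by (intro sum.reindex_bij_betw[symmetric] bij_betw_nth) auto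
  finally show ?thesis .
qed

lemma representation_combination:
  assumes bs: "ordered_basis bs" and j: "j < length bs"
  shows "representation (set bs) (\<Sum>i<length bs. a i *s bs ! i) (bs ! j) = a j"
proof -
  have ind: "independent (set bs)" and dist: "distinct bs"
    using bs by (auto simp: ordered_basis_def)
  have "representation (set bs) (\<Sum>i<length bs. a i *s bs ! i) (bs ! j)
      = (\<Sum>i<length bs. a i * representation (set bs) (bs ! i) (bs ! j))"
    using ind by (subst representation_sum) (auto simp: representation_scale span_base span_scale)
  also have "\<dots> = (\<Sum>i<length bs. a i * (if i = j then 1 else 0))"
    using ind dist j by (intro sum.cong) (auto simp: representation_basis nth_eq_iff_index_eq)
  also have "\<dots> = a j" using j by (simp add: if_distrib cong: if_cong)
  finally show ?thesis .
qed

lemma matrix_wrt_eqI: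
  assumes bs: "ordered_basis bs" and X: "X \<in> carrier_mat (length bs) (length bs)"
    and f: "\<And>j. j < length bs \<Longrightarrow> f (bs ! j) = (\<Sum>i<length bs. X $$ (i,j) *s bs ! i)"
  shows "matrix_wrt bs f = X"
  using X f representation_combination[OF bs] unfolding matrix_wrt_def
  by (intro eq_matI) auto

lemma matrix_wrt_carrier: "matrix_wrt bs f \<in> carrier_mat (length bs) (length bs)"
  by (simp add: matrix_wrt_def)

text \<open>
  The product in \<open>reflection_factorization\<close>. It depends on the form and not on \<open>V\<close>, so a space
  and its subspaces share it.
\<close>

definition reflection_product :: "'v list \<Rightarrow> 'v \<Rightarrow> 'v" where
  "reflection_product vs = foldr (\<lambda>v g. reflection v \<circ> g) vs id"

lemma reflection_product_simps [simp]:
  "reflection_product [] x = x"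
  "reflection_product (v # vs) x = reflection v (reflection_product vs x)"
  by (simp_all add: reflection_product_def)

lemma reflection_product_append [simp]:
  "reflection_product (vs @ ws) x = reflection_product vs (reflection_product ws x)"
  by (induction vs) auto

lemma reflection_factorization_iff:
  "reflection_factorization f vs \<longleftrightarrow>
     (\<forall>v\<in>set vs. v \<in> V \<and> \<Psi> v v \<noteq> 0) \<and> (\<forall>x\<in>V. f x = reflection_product vs x)"
  by (simp add: reflection_factorization_def reflection_product_def)

lemma reflection_in_V: "v \<in> V \<Longrightarrow> x \<in> V \<Longrightarrow> reflection v x \<in> V"
  unfolding reflection_def by (intro diff_in_V scale_in_V)

lemma reflection_product_in_V: "set vs \<subseteq> V \<Longrightarrow> x \<in> V \<Longrightarrow> reflection_product vs x \<in> V"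
  by (induction vs) (auto intro: reflection_in_V)

lemma reflection_involution:
  assumes "v \<in> V" "x \<in> V" "\<Psi> v v \<noteq> 0"
  shows "reflection v (reflection v x) = x"
proof -
  have "\<Psi> (reflection v x) v = - \<Psi> x v"
    using assms by (simp add: reflection_def form_diff form_scale scale_in_V)
  then show ?thesis
    unfolding reflection_def by simp
qed

lemma reflection_product_rev:
  assumes "\<forall>v\<in>set vs. v \<in> V \<and> \<Psi> v v \<noteq> 0" and "x \<in> V"
  shows "reflection_product (rev vs) (reflection_product vs x) = x"
  using assms
proof (induction vs)
  case (Cons v vs)
  moreover have "reflection_product vs x \<in> V"
    using Cons.prems by (intro reflection_product_in_V) auto
  ultimately show ?case by (simp add: reflection_involution)
qed simp

text \<open>
  With \<open>x\<^sub>m = x\<close> and \<open>x\<^sub>i = reflection v\<^sub>i x\<^sub>i\<^sub>+\<^sub>1 = x\<^sub>i\<^sub>+\<^sub>1 - c\<^sub>i v\<^sub>i\<close>, the coefficient \<open>c\<^sub>i\<close> satisfies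
  \<open>\<Psi> v\<^sub>i v\<^sub>i / 2 \<cdot> c\<^sub>i + (\<Sum>j>i. c\<^sub>j \<Psi> v\<^sub>j v\<^sub>i) = \<Psi> x v\<^sub>i\<close>. These triangular equations are
  \<open>M C = W\<close> for the matrix \<open>C\<close> of the coefficients, and \<open>1 - U C\<close> is the matrix of \<open>f\<close>. The
  alternating matrix is \<open>K = M - S/2 = M (1 - C U / 2)\<close>.
\<close>

lemma spinor_determinant_formula:
  assumes two: "(2::'k) \<noteq> 0" and bs: "ordered_basis bs" and fac: "reflection_factorization f vs"
  obtains K where "K \<in> carrier_mat (length vs) (length vs)" and "alternating_mat K"
    and "(\<Prod>v\<leftarrow>vs. \<Psi> v v) * det (1\<^sub>m (length bs) + matrix_wrt bs f)
      = 2 ^ (length bs + length vs) * det K"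
proof -
  define n where "n = length bs"
  define m where "m = length vs"
  have vV: "vs ! i \<in> V" "\<Psi> (vs ! i) (vs ! i) \<noteq> 0" if "i < m" for i
    using fac that unfolding reflection_factorization_iff m_def by auto
  have bV: "bs ! i \<in> V" if "i < n" for i
    using ordered_basis_in_V[OF bs] that by (simp add: n_def)
  \<comment> \<open>\<open>g i x\<close> is \<open>x\<close> after the reflections with index \<open>\<ge> i\<close>;
    step \<open>i\<close> subtracts \<open>c i x\<close> times \<open>vs ! i\<close>\<close>
  define g where "g i x = reflection_product (drop i vs) x" for i x
  define c where "c i x = 2 * \<Psi> (g (Suc i) x) (vs ! i) / \<Psi> (vs ! i) (vs ! i)" for i x
  have g_step: "g i x = g (Suc i) x - c i x *s vs ! i" if "i < m" for i x
    using that unfolding g_def m_def by (simp add: Cons_nth_drop_Suc[symmetric] reflection_def c_def g_def)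
  have g_sum: "g i x = x - (\<Sum>j\<in>{i..<m}. c j x *s vs ! j)" if "i \<le> m" for i x
    using that
  proof (induction rule: inc_induct)
    case base
    show ?case by (simp add: g_def m_def)
  next
    case (step i)
    then show ?case
      by (simp add: g_step sum.atLeast_Suc_lessThan)
  qed
  \<comment> \<open>the triangular equations \<open>M C = W\<close> for the coefficients\<close>
  have c_eq: "\<Psi> (vs ! i) (vs ! i) / 2 * c i x + (\<Sum>j\<in>{Suc i..<m}. c j x * \<Psi> (vs ! j) (vs ! i))
      = \<Psi> x (vs ! i)" if i: "i < m" and x: "x \<in> V" for i x
  proof -
    have "\<Psi> (vs ! i) (vs ! i) / 2 * c i x = \<Psi> (g (Suc i) x) (vs ! i)"
      using two vV(2)[OF i] by (simp add: c_def)
    also have "\<dots> = \<Psi> x (vs ! i) - \<Psi> (\<Sum>j\<in>{Suc i..<m}. c j x *s vs ! j) (vs ! i)"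
      using i x vV by (simp add: g_sum) (intro form_diff sum_in_V scale_in_V, auto)
    also have "\<Psi> (\<Sum>j\<in>{Suc i..<m}. c j x *s vs ! j) (vs ! i)
        = (\<Sum>j\<in>{Suc i..<m}. c j x * \<Psi> (vs ! j) (vs ! i))"
      using i vV by (intro form_sum) auto
    finally show ?thesis by (metis diff_add_cancel)
  qed
  define U where "U = mat n m (\<lambda>(i,j). representation (set bs) (vs ! j) (bs ! i))"
  define C where "C = mat m n (\<lambda>(j,l). c j (bs ! l))"
  define M where "M = mat m m (\<lambda>(i,j). if i = j then \<Psi> (vs ! i) (vs ! i) / 2
     else if i < j then \<Psi> (vs ! j) (vs ! i) else 0)"
  define W where "W = mat m n (\<lambda>(i,l). \<Psi> (bs ! l) (vs ! i))"
  define S where "S = mat m m (\<lambda>(i,l). \<Psi> (vs ! l) (vs ! i))"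
  define K where "K = mat m m (\<lambda>(i,j). if i = j then 0
     else if i < j then \<Psi> (vs ! j) (vs ! i) / 2 else - \<Psi> (vs ! j) (vs ! i) / 2)"
  have car: "U \<in> carrier_mat n m" "C \<in> carrier_mat m n" "M \<in> carrier_mat m m"
    "W \<in> carrier_mat m n" "S \<in> carrier_mat m m" "K \<in> carrier_mat m m"
    by (auto simp: U_def C_def M_def W_def S_def K_def)
  have v_exp: "vs ! j = (\<Sum>i<n. U $$ (i,j) *s bs ! i)" if "j < m" for j
  proof -
    have "vs ! j = (\<Sum>i<length bs. representation (set bs) (vs ! j) (bs ! i) *s bs ! i)"
      by (rule basis_expansion[OF bs vV(1)[OF that]])
    also have "\<dots> = (\<Sum>i<n. U $$ (i,j) *s bs ! i)"
      using that by (intro sum.cong) (auto simp: U_def n_def)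
    finally show ?thesis .
  qed
  have G: "matrix_wrt bs f = 1\<^sub>m n - U * C"
  proof (rule matrix_wrt_eqI[OF bs])
    show "1\<^sub>m n - U * C \<in> carrier_mat (length bs) (length bs)"
      using car by (auto simp: n_def)
    fix l assume "l < length bs"
    then have l: "l < n" by (simp add: n_def)
    have one: "bs ! l = (\<Sum>i<n. 1\<^sub>m n $$ (i,l) *s bs ! i)"
      using l by (simp add: if_distrib[where f = "\<lambda>a. a *s _"] cong: if_cong)
    have "f (bs ! l) = g 0 (bs ! l)"
      using fac bV[OF l] by (simp add: reflection_factorization_iff g_def)
    also have "\<dots> = bs ! l - (\<Sum>j<m. c j (bs ! l) *s vs ! j)"
      by (simp add: g_sum atLeast0LessThan)
    also have "(\<Sum>j<m. c j (bs ! l) *s vs ! j) = (\<Sum>j<m. \<Sum>i<n. (C $$ (j,l) * U $$ (i,j)) *s bs ! i)"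
    proof (rule sum.cong[OF refl])
      fix j assume "j \<in> {..<m}"
      then have j: "j < m" by simp
      have "c j (bs ! l) *s vs ! j = C $$ (j,l) *s (\<Sum>i<n. U $$ (i,j) *s bs ! i)"
        using j l v_exp[OF j] by (simp add: C_def)
      then show "c j (bs ! l) *s vs ! j = (\<Sum>i<n. (C $$ (j,l) * U $$ (i,j)) *s bs ! i)"
        by (simp add: scale_sum_right)
    qed
    also have "\<dots> = (\<Sum>i<n. (U * C) $$ (i,l) *s bs ! i)"
      using l car by (subst sum.swap)
        (auto simp: scalar_prod_def scale_sum_left atLeast0LessThan mult.commute intro!: sum.cong)
    also have "bs ! l - (\<Sum>i<n. (U * C) $$ (i,l) *s bs ! i)
        = (\<Sum>i<n. 1\<^sub>m n $$ (i,l) *s bs ! i) - (\<Sum>i<n. (U * C) $$ (i,l) *s bs ! i)"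
      by (simp only: one[symmetric])
    also have "(\<Sum>i<n. 1\<^sub>m n $$ (i,l) *s bs ! i) - (\<Sum>i<n. (U * C) $$ (i,l) *s bs ! i)
        = (\<Sum>i<n. (1\<^sub>m n - U * C) $$ (i,l) *s bs ! i)"
      using l car by (simp add: sum_subtractf[symmetric] scale_left_diff_distrib[symmetric])
    finally show "f (bs ! l) = (\<Sum>i<length bs. (1\<^sub>m n - U * C) $$ (i,l) *s bs ! i)"
      by (simp add: n_def)
  qed
  have MC: "M * C = W"
  proof (rule eq_matI)
    fix i l assume "i < dim_row W" "l < dim_col W"
    then have i: "i < m" and l: "l < n" using car by auto
    have "(M * C) $$ (i,l) = (\<Sum>j<m. M $$ (i,j) * c j (bs ! l))"
      using i l car by (auto simp: scalar_prod_def atLeast0LessThan C_def)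
    also have "{..<m} = {..<i} \<union> {i} \<union> {Suc i..<m}" using i by auto
    also have "(\<Sum>j\<in>{..<i} \<union> {i} \<union> {Suc i..<m}. M $$ (i,j) * c j (bs ! l))
        = \<Psi> (vs ! i) (vs ! i) / 2 * c i (bs ! l)
          + (\<Sum>j\<in>{Suc i..<m}. c j (bs ! l) * \<Psi> (vs ! j) (vs ! i))"
    proof -
      have "(\<Sum>j<i. M $$ (i,j) * c j (bs ! l)) = 0"
        using i by (intro sum.neutral) (auto simp: M_def)
      moreover have "(\<Sum>j\<in>{Suc i..<m}. M $$ (i,j) * c j (bs ! l))
          = (\<Sum>j\<in>{Suc i..<m}. c j (bs ! l) * \<Psi> (vs ! j) (vs ! i))"
        using i by (intro sum.cong) (auto simp: M_def)
      moreover have "M $$ (i,i) = \<Psi> (vs ! i) (vs ! i) / 2" using i by (simp add: M_def)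
      ultimately show ?thesis
        by (subst sum.union_disjoint; (subst sum.union_disjoint)?) auto
    qed
    also have "\<dots> = W $$ (i,l)" using c_eq[OF i bV[OF l]] i l by (simp add: W_def)
    finally show "(M * C) $$ (i,l) = W $$ (i,l)" .
  qed (use car in auto)
  have WU: "W * U = S"
  proof (rule eq_matI)
    fix i l assume "i < dim_row S" "l < dim_col S"
    then have i: "i < m" and l: "l < m" using car by auto
    have "S $$ (i,l) = \<Psi> (\<Sum>k<n. U $$ (k,l) *s bs ! k) (vs ! i)"
      using i l v_exp[OF l] by (simp add: S_def)
    also have "\<dots> = (\<Sum>k<n. U $$ (k,l) * \<Psi> (bs ! k) (vs ! i))"
      using bV vV(1)[OF i] by (intro form_sum) auto
    also have "\<dots> = (W * U) $$ (i,l)"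
      using i l car by (auto simp: scalar_prod_def W_def atLeast0LessThan mult.commute intro!: sum.cong)
    finally show "(W * U) $$ (i,l) = S $$ (i,l)" ..
  qed (use car in auto)
  \<comment> \<open>the factor 1/2 turns \<open>2 - U C\<close> into \<open>2 (1 - U H)\<close>\<close>
  define H where "H = (1/2) \<cdot>\<^sub>m C"
  have H: "H \<in> carrier_mat m n" using car by (simp add: H_def)
  have K_eq: "M * (1\<^sub>m m - H * U) = K"
  proof -
    have "M * (H * U) = (1/2) \<cdot>\<^sub>m S"
    proof -
      have "M * (H * U) = (M * H) * U" using car H by (simp add: assoc_mult_mat[of _ m m _ n _ m])
      also have "M * H = (1/2) \<cdot>\<^sub>m W" using car MC by (simp add: H_def mult_smult_distrib)
      also have "\<dots> * U = (1/2) \<cdot>\<^sub>m S" using car WU by (simp add: mult_smult_assoc_mat)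
      finally show ?thesis .
    qed
    moreover have "M * (1\<^sub>m m - H * U) = M - M * (H * U)"
      using car H by (subst mult_minus_distrib_mat[of _ m m]) auto
    moreover have "M - (1/2) \<cdot>\<^sub>m S = K"
    proof (rule eq_matI)
      fix i j assume "i < dim_row K" "j < dim_col K"
      then have ij: "i < m" "j < m" using car by auto
      have half: "a - a / 2 = a / 2" for a :: 'k
        using two by (simp add: field_simps)
      show "(M - (1/2) \<cdot>\<^sub>m S) $$ (i,j) = K $$ (i,j)"
        using ij two by (simp add: M_def S_def K_def half)
    qed (use car in auto)
    ultimately show ?thesis by simp
  qed
  have "alternating_mat K"
  proof (rule alternating_matI[OF car(6)])
    show "K $$ (i,i) = 0" if "i < m" for i using that by (simp add: K_def)
    show "K $$ (j,i) = - K $$ (i,j)" if "i < m" "j < m" for i j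
      using that form_sym[OF vV(1)[OF that(1)] vV(1)[OF that(2)]] by (auto simp: K_def)
  qed
  moreover have "(\<Prod>v\<leftarrow>vs. \<Psi> v v) * det (1\<^sub>m n + matrix_wrt bs f) = 2 ^ (n + m) * det K"
  proof -
    have "1\<^sub>m n + matrix_wrt bs f = 2 \<cdot>\<^sub>m (1\<^sub>m n - U * H)"
      using car two unfolding G H_def by (intro eq_matI) (auto simp: algebra_simps)
    then have "det (1\<^sub>m n + matrix_wrt bs f) = 2 ^ n * det (1\<^sub>m n - U * H)"
      using car H by (simp add: det_smult)
    also have "det (1\<^sub>m n - U * H) = det (1\<^sub>m m - H * U)"
      using car H by (intro det_one_minus_mult_commute)
    finally have 1: "det (1\<^sub>m n + matrix_wrt bs f) = 2 ^ n * det (1\<^sub>m m - H * U)" .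
    have "upper_triangular M" using car by (auto simp: M_def)
    then have "det M = prod_list (diag_mat M)"
      by (rule det_upper_triangular) (rule car)
    also have "diag_mat M = map (\<lambda>v. \<Psi> v v / 2) vs"
      by (rule nth_equalityI) (auto simp: diag_mat_def M_def m_def)
    also have "prod_list (map (\<lambda>v. \<Psi> v v / 2) us) * 2 ^ length us = (\<Prod>v\<leftarrow>us. \<Psi> v v)" for us
      using two by (induction us) auto
    finally have 2: "(\<Prod>v\<leftarrow>vs. \<Psi> v v) = 2 ^ m * det M" by (simp add: m_def mult.commute)
    have "det K = det M * det (1\<^sub>m m - H * U)"
      unfolding K_eq[symmetric] using car H by (intro det_mult) auto
    with 1 2 show ?thesis by (simp add: power_add)
  qed
  ultimately show ?thesis using that car(6) by (simp add: n_def m_def)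
qed

text \<open>
  If the determinant does not vanish, then neither does the determinant of the alternating matrix
  in \<open>spinor_determinant_formula\<close>; so the number of reflections is even and the power of 2 that
  depends on it is a square.
\<close>

lemma spinor_product_det:
  assumes two: "(2::'k) \<noteq> 0" and bs: "ordered_basis bs" and fac: "reflection_factorization f vs"
    and det0: "det (1\<^sub>m (length bs) + matrix_wrt bs f) \<noteq> 0"
  shows "square_class (\<Prod>v\<leftarrow>vs. \<Psi> v v)
    = square_class (2 ^ length bs * det (1\<^sub>m (length bs) + matrix_wrt bs f))"
proof -
  let ?p = "\<Prod>v\<leftarrow>vs. \<Psi> v v" and ?D = "det (1\<^sub>m (length bs) + matrix_wrt bs f)" and ?n = "length bs"
  obtain K where K: "K \<in> carrier_mat (length vs) (length vs)" and alt: "alternating_mat K"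
    and eq: "?p * ?D = 2 ^ (?n + length vs) * det K"
    using spinor_determinant_formula[OF two bs fac] .
  have "?p \<noteq> 0"
    using fac unfolding reflection_factorization_iff by (auto simp: prod_list_zero_iff)
  then have K0: "det K \<noteq> 0" using eq det0 by auto
  obtain t where t: "det K = t\<^sup>2" using det_alternating_is_square[OF alt] by blast
  obtain r where r: "length vs = 2 * r"
    using alternating_dim_even[OF alt K K0 two] by blast
  show ?thesis
  proof (rule square_class_mult_square_eqI)
    show "?p * (2 ^ ?n * ?D) = (2 ^ ?n * 2 ^ r * t)\<^sup>2"
      using eq t r by (simp add: algebra_simps power_add power_mult power2_eq_square power_mult_distrib)
    show "2 ^ ?n * 2 ^ r * t \<noteq> 0" using K0 t two by auto
  qed
qed

lemma matrix_wrt_id: "ordered_basis bs \<Longrightarrow> matrix_wrt bs id = 1\<^sub>m (length bs)"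
  by (rule matrix_wrt_eqI)
    (auto simp: if_distrib[where f = "\<lambda>a. a *s _"] cong: if_cong)

text \<open>
  The determinant formula for the identity: \<open>det (1 + 1) = 2^n\<close> cancels the power of 2.
\<close>

lemma reflections_of_identity_square:
  assumes two: "(2::'k) \<noteq> 0" and fac: "reflection_factorization id vs"
  shows "\<exists>s. s \<noteq> 0 \<and> (\<Prod>v\<leftarrow>vs. \<Psi> v v) = s\<^sup>2"
proof -
  obtain bs where bs: "ordered_basis bs" using ordered_basis_exists by blast
  have "1\<^sub>m (length bs) + 1\<^sub>m (length bs) = (2::'k) \<cdot>\<^sub>m 1\<^sub>m (length bs)"
    by (rule eq_matI) auto
  then have D: "det (1\<^sub>m (length bs) + matrix_wrt bs id) = 2 ^ length bs"
    by (simp add: matrix_wrt_id[OF bs] det_smult)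
  have "square_class (\<Prod>v\<leftarrow>vs. \<Psi> v v) = square_class ((2 ^ length bs) * 2 ^ length bs)"
    using spinor_product_det[OF two bs fac] two by (simp add: D)
  moreover have "(2 ^ length bs) * 2 ^ length bs \<in> square_class ((2::'k) ^ length bs * 2 ^ length bs)"
    unfolding square_class_def by (auto intro!: exI[where x = 1])
  ultimately have "(2 ^ length bs) * 2 ^ length bs \<in> square_class (\<Prod>v\<leftarrow>vs. \<Psi> v v)" by simp
  then obtain s where s: "s \<noteq> 0" "(2 ^ length bs) * 2 ^ length bs = (\<Prod>v\<leftarrow>vs. \<Psi> v v) * s\<^sup>2"
    unfolding square_class_def by blast
  then have "(\<Prod>v\<leftarrow>vs. \<Psi> v v) = (2 ^ length bs / s)\<^sup>2"
    by (simp add: power_divide power2_eq_square)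
  then show ?thesis using s two by (intro exI[where x = "2 ^ length bs / s"]) auto
qed

text \<open>
  Two factorizations of \<open>f\<close>, one of them reversed, combine to a factorization of the identity.
\<close>

lemma spinor_norm_eq:
  assumes two: "(2::'k) \<noteq> 0" and fac: "reflection_factorization f vs"
  shows "spinor_norm f = square_class (\<Prod>v\<leftarrow>vs. \<Psi> v v)"
proof -
  have unique: "square_class (\<Prod>v\<leftarrow>ws. \<Psi> v v) = square_class (\<Prod>v\<leftarrow>vs. \<Psi> v v)"
    if ws: "reflection_factorization f ws" for ws
  proof -
    have "reflection_factorization id (rev ws @ vs)"
      using fac ws reflection_product_rev[of ws]
      unfolding reflection_factorization_iff
      by auto
    from reflections_of_identity_square[OF two this]
    obtain s where "s \<noteq> 0" "(\<Prod>v\<leftarrow>ws. \<Psi> v v) * (\<Prod>v\<leftarrow>vs. \<Psi> v v) = s\<^sup>2"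
      by (auto simp: rev_map[symmetric] prod_list.rev)
    then show ?thesis by (intro square_class_mult_square_eqI)
  qed
  show ?thesis unfolding spinor_norm_def
    by (rule the_equality) (use fac unique in blast)+
qed

end

section \<open>Base change and the theorem of Cartan and Dieudonne\<close>

context quadratic_space
begin

text \<open>
  The columns are the coordinates of the vectors \<open>xs\<close> in the basis \<open>bs\<close>; the case \<open>xs = map f bs\<close> is
  the matrix of \<open>f\<close>, and the case of a second basis is the matrix of the change of basis.
\<close>

definition coord_mat :: "'v list \<Rightarrow> 'v list \<Rightarrow> 'k mat" where
  "coord_mat bs xs = mat (length bs) (length xs) (\<lambda>(i,j). representation (set bs) (xs ! j) (bs ! i))"

lemma coord_mat_carrier: "coord_mat bs xs \<in> carrier_mat (length bs) (length xs)"
  by (simp add: coord_mat_def)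

lemma coord_mat_expansion:
  assumes bs: "ordered_basis bs" and xs: "set xs \<subseteq> V" and j: "j < length xs"
  shows "xs ! j = (\<Sum>i<length bs. coord_mat bs xs $$ (i,j) *s bs ! i)"
proof -
  have "xs ! j \<in> V" using xs j by auto
  then have "xs ! j = (\<Sum>i<length bs. representation (set bs) (xs ! j) (bs ! i) *s bs ! i)"
    by (rule basis_expansion[OF bs])
  also have "\<dots> = (\<Sum>i<length bs. coord_mat bs xs $$ (i,j) *s bs ! i)"
    using j by (intro sum.cong) (auto simp: coord_mat_def)
  finally show ?thesis .
qed

lemma coord_mat_eqI:
  assumes bs: "ordered_basis bs" and X: "X \<in> carrier_mat (length bs) (length xs)"
    and exp: "\<And>j. j < length xs \<Longrightarrow> xs ! j = (\<Sum>i<length bs. X $$ (i,j) *s bs ! i)"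
  shows "coord_mat bs xs = X"
proof (rule eq_matI)
  fix i j assume "i < dim_row X" "j < dim_col X"
  then have ij: "i < length bs" "j < length xs" using X by auto
  have "representation (set bs) (xs ! j) (bs ! i)
      = representation (set bs) (\<Sum>i<length bs. X $$ (i,j) *s bs ! i) (bs ! i)"
    using exp[OF ij(2)] by (rule arg_cong)
  then show "coord_mat bs xs $$ (i,j) = X $$ (i,j)"
    using ij representation_combination[OF bs ij(1)] by (simp add: coord_mat_def)
qed (use X in \<open>auto simp: coord_mat_def\<close>)

text \<open>
  Base change and composition at once: both directions of the intertwining relation in
  \<open>characteristic_poly_eq\<close> are instances.
\<close>

lemma coord_mat_mult:
  assumes bs: "ordered_basis bs" and xs: "set xs \<subseteq> V" and Y: "Y \<in> carrier_mat (length xs) (length ys)"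
    and exp: "\<And>j. j < length ys \<Longrightarrow> ys ! j = (\<Sum>k<length xs. Y $$ (k,j) *s xs ! k)"
  shows "coord_mat bs ys = coord_mat bs xs * Y"
proof (rule coord_mat_eqI[OF bs])
  have car: "coord_mat bs xs \<in> carrier_mat (length bs) (length xs)" by (rule coord_mat_carrier)
  then show "coord_mat bs xs * Y \<in> carrier_mat (length bs) (length ys)" using Y by auto
  fix j assume j: "j < length ys"
  have "ys ! j = (\<Sum>k<length xs. Y $$ (k,j) *s (\<Sum>i<length bs. coord_mat bs xs $$ (i,k) *s bs ! i))"
    unfolding exp[OF j] using coord_mat_expansion[OF bs xs] by (intro sum.cong) auto
  also have "\<dots> = (\<Sum>i<length bs. (coord_mat bs xs * Y) $$ (i,j) *s bs ! i)"
    unfolding scale_sum_right using j car Y by (subst sum.swap)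
      (auto simp: scalar_prod_def scale_sum_left atLeast0LessThan mult.commute intro!: sum.cong)
  finally show "ys ! j = (\<Sum>i<length bs. (coord_mat bs xs * Y) $$ (i,j) *s bs ! i)" .
qed

lemma coord_mat_self: "ordered_basis bs \<Longrightarrow> coord_mat bs bs = 1\<^sub>m (length bs)"
  by (rule coord_mat_eqI)
    (auto simp: if_distrib[where f = "\<lambda>a. a *s _"] cong: if_cong)

lemma matrix_wrt_eq_coord_mat: "matrix_wrt bs f = coord_mat bs (map f bs)"
  by (rule eq_matI) (auto simp: matrix_wrt_def coord_mat_def)

lemma ordered_basis_subset: "ordered_basis bs \<Longrightarrow> set bs \<subseteq> V"
  unfolding ordered_basis_def by (metis span_superset)

lemma ordered_basis_length_eq:
  assumes "ordered_basis bs" and "ordered_basis cs"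
  shows "length bs = length cs"
proof -
  have "card (set bs) \<le> card (set cs)" "card (set cs) \<le> card (set bs)"
    using assms independent_span_bound[of "set bs" "set cs"] independent_span_bound[of "set cs" "set bs"]
      ordered_basis_subset unfolding ordered_basis_def by auto
  then show ?thesis using assms unfolding ordered_basis_def by (simp add: distinct_card)
qed

text \<open>
  The basis chosen in the definition of \<open>characteristic_poly\<close> is unknown, so its matrix is compared
  with the one in the given basis: both \<open>P * matrix_wrt cs f\<close> and \<open>matrix_wrt bs f * P\<close> contain the
  coordinates of the images \<open>f (cs ! j)\<close> in the basis \<open>bs\<close>.
\<close>

lemma characteristic_poly_eq:
  assumes bs: "ordered_basis bs" and f_V: "\<And>x. x \<in> V \<Longrightarrow> f x \<in> V"
    and f_add: "\<And>x y. x \<in> V \<Longrightarrow> y \<in> V \<Longrightarrow> f (x + y) = f x + f y"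
    and f_scale: "\<And>c x. x \<in> V \<Longrightarrow> f (c *s x) = c *s f x"
  shows "characteristic_poly f = char_poly (matrix_wrt bs f)"
proof -
  define cs where "cs = (SOME bs. ordered_basis bs)"
  have cs: "ordered_basis cs" unfolding cs_def using ordered_basis_exists by (rule someI_ex)
  define n where "n = length bs"
  have len: "length bs = n" "length cs = n"
    using ordered_basis_length_eq[OF bs cs] by (simp_all add: n_def)
  have f_sum: "f (\<Sum>i<k. c i *s x i) = (\<Sum>i<k. c i *s f (x i))" if "\<And>i. i < k \<Longrightarrow> x i \<in> V"
    for c x and k :: nat
    using that
  proof (induction k)
    case 0
    show ?case using f_scale[OF zero_in_V, of 0] by simp
  next
    case (Suc k)
    have "f ((\<Sum>i<k. c i *s x i) + c k *s x k) = f (\<Sum>i<k. c i *s x i) + f (c k *s x k)"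
      using Suc.prems by (intro f_add sum_in_V scale_in_V) auto
    then show ?case using Suc by (simp add: f_scale)
  qed
  have image: "set (map f xs) \<subseteq> V" if "set xs \<subseteq> V" for xs
    using that f_V by auto
  define P where "P = coord_mat bs cs"
  define Q where "Q = coord_mat cs bs"
  note bsV = ordered_basis_subset[OF bs] and csV = ordered_basis_subset[OF cs]
  have car: "P \<in> carrier_mat n n" "Q \<in> carrier_mat n n"
    "matrix_wrt bs f \<in> carrier_mat n n" "matrix_wrt cs f \<in> carrier_mat n n"
    using coord_mat_carrier[of bs cs] coord_mat_carrier[of cs bs] matrix_wrt_carrier[of bs f]
      matrix_wrt_carrier[of cs f] by (simp_all add: P_def Q_def len)
  have PQ: "P * Q = 1\<^sub>m n"
    using coord_mat_mult[OF bs csV coord_mat_carrier coord_mat_expansion[OF cs bsV]]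
    by (simp add: P_def Q_def len coord_mat_self[OF bs])
  have QP: "Q * P = 1\<^sub>m n"
    using coord_mat_mult[OF cs bsV coord_mat_carrier coord_mat_expansion[OF bs csV]]
    by (simp add: P_def Q_def len coord_mat_self[OF cs])
  have PB: "coord_mat bs (map f cs) = P * matrix_wrt cs f"
    unfolding P_def matrix_wrt_eq_coord_mat
    using csV by (intro coord_mat_mult[OF bs csV] coord_mat_expansion[OF cs] image coord_mat_carrier)
  have AP: "coord_mat bs (map f cs) = matrix_wrt bs f * P"
    unfolding P_def matrix_wrt_eq_coord_mat
  proof (rule coord_mat_mult[OF bs image[OF bsV]])
    show "coord_mat bs cs \<in> carrier_mat (length (map f bs)) (length (map f cs))"
      using coord_mat_carrier[of bs cs] by simp
    fix j assume "j < length (map f cs)"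
    then have j: "j < length cs" by simp
    have "f (cs ! j) = f (\<Sum>k<length bs. coord_mat bs cs $$ (k,j) *s bs ! k)"
      by (rule arg_cong[OF coord_mat_expansion[OF bs csV j]])
    also have "\<dots> = (\<Sum>k<length bs. coord_mat bs cs $$ (k,j) *s f (bs ! k))"
      using bsV by (intro f_sum) auto
    finally show "map f cs ! j = (\<Sum>k<length (map f bs). coord_mat bs cs $$ (k,j) *s map f bs ! k)"
      using j by simp
  qed
  have "matrix_wrt bs f = matrix_wrt bs f * (P * Q)"
    using car by (simp add: PQ)
  also have "\<dots> = (matrix_wrt bs f * P) * Q"
    using car by (simp add: assoc_mult_mat)
  also have "\<dots> = P * matrix_wrt cs f * Q" by (simp add: AP[symmetric] PB)
  finally have "similar_mat (matrix_wrt bs f) (matrix_wrt cs f)"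
    using car PQ QP by (intro similar_matI[of _ _ P Q n]) auto
  then show ?thesis
    unfolding characteristic_poly_def cs_def[symmetric] by (rule char_poly_similar[symmetric])
qed

lemma dim_eq_length_basis: "ordered_basis bs \<Longrightarrow> dim V = length bs"
  unfolding ordered_basis_def by (metis dim_eq_card_independent dim_span distinct_card)

lemma isometryD:
  assumes "isometry f"
  shows "x \<in> V \<Longrightarrow> f x \<in> V"
    and "x \<in> V \<Longrightarrow> y \<in> V \<Longrightarrow> f (x + y) = f x + f y"
    and "x \<in> V \<Longrightarrow> f (c *s x) = c *s f x"
    and "x \<in> V \<Longrightarrow> y \<in> V \<Longrightarrow> \<Psi> (f x) (f y) = \<Psi> x y"
    and "y \<in> V \<Longrightarrow> \<exists>x\<in>V. f x = y"
proof -
  have bij: "bij_betw f V V" using assms by (simp add: isometry_def)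
  show "x \<in> V \<Longrightarrow> f x \<in> V" by (rule bij_betwE[OF bij, rule_format])
  show "y \<in> V \<Longrightarrow> \<exists>x\<in>V. f x = y" using bij_betw_imp_surj_on[OF bij] by (metis imageE)
qed (use assms in \<open>simp_all add: isometry_def\<close>)

lemma isometry_compose: "isometry f \<Longrightarrow> isometry g \<Longrightarrow> isometry (f \<circ> g)"
proof -
  assume f: "isometry f" and g: "isometry g"
  then have "bij_betw (f \<circ> g) V V"
    unfolding isometry_def by (metis bij_betw_trans)
  then show "isometry (f \<circ> g)"
    unfolding isometry_def using isometryD[OF f] isometryD[OF g] by simp
qed

lemma isometry_reflection:
  assumes v: "v \<in> V" "\<Psi> v v \<noteq> 0"
  shows "isometry (reflection v)"
proof -
  have "bij_betw (reflection v) V V"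
    using v reflection_in_V reflection_involution
    by (intro bij_betw_byWitness[of _ "reflection v"]) auto
  moreover have "reflection v (x + y) = reflection v x + reflection v y" if "x \<in> V" "y \<in> V" for x y
    using that v
    by (simp add: reflection_def form_add algebra_simps add_divide_distrib scale_left_distrib)
  moreover have "reflection v (c *s x) = c *s reflection v x" if "x \<in> V" for c x
    using that v by (simp add: reflection_def form_scale scale_right_diff_distrib algebra_simps)
  moreover have "\<Psi> (reflection v x) (reflection v y) = \<Psi> x y" if "x \<in> V" "y \<in> V" for x y
    using that v form_sym[of v y]
    by (simp add: reflection_def form_diff form_diff_right form_scale form_scale_right
        scale_in_V diff_in_V field_simps)
  ultimately show ?thesis unfolding isometry_def by blast
qed

lemma isometry_reflection_product:
  assumes "\<forall>v\<in>set vs. v \<in> V \<and> \<Psi> v v \<noteq> 0"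
  shows "isometry (reflection_product vs)"
  using assms
proof (induction vs)
  case Nil
  have "reflection_product [] = id" by (rule ext) simp
  then show ?case by (simp add: isometry_def bij_betw_def inj_on_def)
next
  case (Cons v vs)
  have "reflection_product (v # vs) = reflection v \<circ> reflection_product vs" by (rule ext) simp
  then show ?case
    using Cons by (simp only:) (intro isometry_compose isometry_reflection, auto)
qed

text \<open>
  Vectors of equal norm satisfy \<open>\<Psi> (w - v) (w - v) = 2 \<Psi> w (w - v)\<close>, so the reflection subtracts
  exactly \<open>w - v\<close> from \<open>w\<close>.
\<close>

lemma reflection_moves_isometric_vector:
  assumes v: "v \<in> V" and w: "w \<in> V" and eq: "\<Psi> w w = \<Psi> v v" and u: "\<Psi> (w - v) (w - v) \<noteq> 0"
  shows "reflection (w - v) w = v"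
proof -
  have "\<Psi> (w - v) (w - v) = 2 * \<Psi> w (w - v)"
    using v w eq form_sym[OF v w]
    by (simp add: form_diff form_diff_right diff_in_V)
  then show ?thesis using u unfolding reflection_def by simp
qed

text \<open>
  The norms of \<open>w - v\<close> and \<open>w + v\<close> add up to \<open>4 \<Psi> v v\<close>, so one of the two vectors is not isotropic.
  In the second case the reflection moves \<open>w\<close> to \<open>- v\<close>, and the reflection in \<open>v\<close> corrects the sign.
\<close>

lemma reflections_move_isometric_vector:
  assumes two: "(2::'k) \<noteq> 0" and v: "v \<in> V" "\<Psi> v v \<noteq> 0" and w: "w \<in> V" and eq: "\<Psi> w w = \<Psi> v v"
  obtains us where "\<forall>u\<in>set us. u \<in> V \<and> \<Psi> u u \<noteq> 0" and "reflection_product us w = v"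
proof (cases "\<Psi> (w - v) (w - v) = 0")
  case False
  then show ?thesis
    using v w eq that[of "[w - v]"] reflection_moves_isometric_vector diff_in_V by simp
next
  case True
  define u where "u = w - (- v)"
  have mv: "- v \<in> V" using scale_in_V[OF v(1), of "- 1"] by simp
  have m: "\<Psi> (- v) z = - \<Psi> v z" "\<Psi> z (- v) = - \<Psi> z v" if "z \<in> V" for z
    using form_scale[OF v(1) that, of "- 1"] form_scale_right[OF that v(1), of "- 1"] by simp_all
  have "\<Psi> u u + \<Psi> (w - v) (w - v) = 2 * 2 * \<Psi> v v"
    unfolding u_def using v w mv eq m
    by (simp add: form_diff form_diff_right diff_in_V del: diff_minus_eq_add)
  then have u: "\<Psi> u u \<noteq> 0" using True two v(2) by (metis add_0 mult_eq_0_iff)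
  have "reflection u w = - v"
    unfolding u_def using v w mv eq u m by (intro reflection_moves_isometric_vector) (auto simp: u_def)
  moreover have "reflection v (- v) = v"
  proof -
    have "reflection v (- v) = (2 - 1) *s v"
      using v m(1)[OF v(1)] by (simp only: scale_left_diff_distrib) (simp add: reflection_def)
    then show ?thesis by simp
  qed
  ultimately show ?thesis
    using that[of "[v, u]"] v u w mv by (simp add: u_def diff_in_V del: diff_minus_eq_add)
qed

text \<open>
  This extends a factorization on the orthogonal complement of \<open>v\<close> to the whole space.
\<close>

lemma reflection_product_fixes_orthogonal:
  assumes v: "v \<in> V" and vs: "\<forall>u\<in>set vs. u \<in> V \<and> \<Psi> u v = 0" and x: "x \<in> V"
  shows "reflection_product vs (c *s v + x) = c *s v + reflection_product vs x"
  using vs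
proof (induction vs)
  case (Cons u vs)
  have "reflection_product vs x \<in> V" using Cons.prems x by (intro reflection_product_in_V) auto
  then have "\<Psi> (c *s v + reflection_product vs x) u = \<Psi> (reflection_product vs x) u"
    using Cons.prems v form_sym[of u v] by (simp add: form_add form_scale scale_in_V)
  then show ?case using Cons by (simp add: reflection_def)
qed simp

lemma subspace_finite_dim:
  assumes "subspace W" and "W \<subseteq> V"
  shows "\<exists>B. finite B \<and> W = span B"
proof -
  obtain B where B: "finite B" "V = span B" using finite_dim_V by blast
  obtain C where C: "C \<subseteq> W" "independent C" "W \<subseteq> span C"
    using maximal_independent_subset by blast
  have "finite C" using independent_span_bound[OF B(1) C(2)] C(1) B(2) assms(2) by auto
  then show ?thesis using C span_minimal[OF C(1) assms(1)] by blast
qed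

end

context nondegenerate_quadratic_space
begin

lemma orthogonal_decomposition:
  assumes "v \<in> V" "\<Psi> v v \<noteq> 0" "x \<in> V"
  obtains c y where "y \<in> V" "\<Psi> y v = 0" "x = c *s v + y"
proof -
  define y where "y = x - (\<Psi> x v / \<Psi> v v) *s v"
  have "y \<in> V" using assms by (auto simp: y_def intro: diff_in_V scale_in_V)
  moreover have "\<Psi> y v = 0" using assms by (simp add: y_def form_diff form_scale scale_in_V)
  ultimately show ?thesis using that[of y "\<Psi> x v / \<Psi> v v"] by (simp add: y_def)
qed

lemma nondegenerate_orthogonal:
  assumes v: "v \<in> V" "\<Psi> v v \<noteq> 0"
  shows "nondegenerate_quadratic_space scale {x \<in> V. \<Psi> x v = 0} \<Psi>"
proof -
  have sub: "subspace {x \<in> V. \<Psi> x v = 0}"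
    using v by (auto simp: subspace_def zero_in_V form_zero_left form_add form_scale add_in_V scale_in_V)
  show ?thesis
  proof unfold_locales
    show "subspace {x \<in> V. \<Psi> x v = 0}" by (rule sub)
    show "\<exists>B. finite B \<and> {x \<in> V. \<Psi> x v = 0} = span B"
      using sub by (rule subspace_finite_dim) auto
    fix x assume x: "x \<in> {x \<in> V. \<Psi> x v = 0}" "\<And>y. y \<in> {x \<in> V. \<Psi> x v = 0} \<Longrightarrow> \<Psi> x y = 0"
    show "x = 0"
    proof (rule nondegenerate)
      show "x \<in> V" using x by simp
      fix y assume "y \<in> V"
      from orthogonal_decomposition[OF v this] obtain c z
        where z: "z \<in> V" "\<Psi> z v = 0" "y = c *s v + z" by blast
      then show "\<Psi> x y = 0"
        using x v by (simp add: form_add_right form_scale_right scale_in_V)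
    qed
  qed (auto simp: form_add form_scale form_sym)
qed

text \<open>
  Polarization: if \<open>x\<close>, \<open>y\<close> and \<open>x + y\<close> are isotropic then \<open>2 \<Psi> x y = 0\<close>.
\<close>

lemma nonisotropic_exists:
  assumes two: "(2::'a) \<noteq> 0" and x: "x \<in> V" "x \<noteq> 0"
  obtains v where "v \<in> V" "\<Psi> v v \<noteq> 0"
proof -
  obtain y where y: "y \<in> V" "\<Psi> x y \<noteq> 0" using nondegenerate x by blast
  have "\<Psi> (x + y) (x + y) = \<Psi> x x + \<Psi> y y + 2 * \<Psi> x y"
    using x(1) y(1) form_sym[of y x] by (simp add: form_add form_add_right add_in_V)
  then have "\<Psi> x x \<noteq> 0 \<or> \<Psi> y y \<noteq> 0 \<or> \<Psi> (x + y) (x + y) \<noteq> 0" using two y by auto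
  then show ?thesis using that x y add_in_V by blast
qed

end

text \<open>
  Induction on the dimension: after composition with reflections the isometry fixes a non-isotropic
  vector \<open>v\<close>, hence preserves its orthogonal complement, which is non-degenerate of smaller dimension.
  The space \<open>V\<close> is a set in a fixed ambient space, so the complement is again an instance of the
  locale, with the same form and the same reflections.
\<close>

lemma (in vector_space) Cartan_Dieudonne:
  assumes two: "(2::'a) \<noteq> 0" and "nondegenerate_quadratic_space scale V \<Psi>"
    and "quadratic_space.isometry scale V \<Psi> f"
  shows "\<exists>vs. quadratic_space.reflection_factorization scale V \<Psi> f vs"
  using assms(2,3)
proof (induction "dim V" arbitrary: V f rule: less_induct)
  case less
  interpret nondegenerate_quadratic_space scale V \<Psi> by (rule less.prems)
  note f = isometryD[OF less.prems(2)]
  show ?case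
  proof (cases "V = {0}")
    case True
    \<comment> \<open>on the zero space the empty product will do\<close>
    have "f x = x" if "x \<in> V" for x using f(1)[OF that] that True by (metis singletonD)
    then have "reflection_factorization f []" by (simp add: reflection_factorization_iff)
    then show ?thesis by blast
  next
    case False
    then obtain x where "x \<in> V" "x \<noteq> 0" using zero_in_V by blast
    then obtain v where v: "v \<in> V" "\<Psi> v v \<noteq> 0" by (rule nonisotropic_exists[OF two])
    obtain us where us: "\<forall>u\<in>set us. u \<in> V \<and> \<Psi> u u \<noteq> 0" "reflection_product us (f v) = v"
      using reflections_move_isometric_vector[OF two v] f v by metis
    \<comment> \<open>\<open>h\<close> fixes \<open>v\<close>\<close>
    define h where "h = reflection_product us \<circ> f"
    have h_iso: "isometry h"
      unfolding h_def using us less.prems(2) by (intro isometry_compose isometry_reflection_product)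
    note h = isometryD[OF h_iso]
    have hv: "h v = v" using us by (simp add: h_def)
    define W where "W = {x \<in> V. \<Psi> x v = 0}"
    have W_nondeg: "nondegenerate_quadratic_space scale W \<Psi>"
      unfolding W_def by (rule nondegenerate_orthogonal[OF v])
    interpret W: nondegenerate_quadratic_space scale W \<Psi> by (rule W_nondeg)
    have "dim W < dim V"
    proof -
      obtain bs where bs: "ordered_basis bs" using ordered_basis_exists by blast
      obtain cs where cs: "W.ordered_basis cs" using W.ordered_basis_exists by blast
      have csW: "span (set cs) = W" "independent (set cs)" using cs by (auto simp: W.ordered_basis_def)
      \<comment> \<open>\<open>v\<close> together with a basis of \<open>W\<close> is independent in \<open>V\<close>\<close>
      have "v \<notin> span (set cs)" using csW v by (simp add: W_def)
      then have "independent (insert v (set cs))" "v \<notin> set cs"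
        using csW by (auto simp: independent_insert span_base)
      moreover have "insert v (set cs) \<subseteq> span (set bs)"
        using W.ordered_basis_subset[OF cs] bs v by (auto simp: W_def ordered_basis_def)
      ultimately have "Suc (card (set cs)) \<le> card (set bs)"
        using independent_span_bound[of "set bs" "insert v (set cs)"] by simp
      then show ?thesis
        using bs cs unfolding dim_eq_length_basis[OF bs] W.dim_eq_length_basis[OF cs]
        by (simp add: ordered_basis_def W.ordered_basis_def distinct_card)
    qed
    moreover have "W.isometry h"
    proof -
      have hW: "h x \<in> W \<longleftrightarrow> x \<in> W" if "x \<in> V" for x
        using that h(1)[OF that] h(4)[OF that v(1)] hv by (simp add: W_def)
      have "inj_on h W" using h_iso unfolding isometry_def bij_betw_def W_def inj_on_def by blast
      moreover have "h ` W = W"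
      proof
        show "h ` W \<subseteq> W" using hW by (auto simp: W_def)
        show "W \<subseteq> h ` W"
        proof
          fix y assume y: "y \<in> W"
          then obtain x where "x \<in> V" "h x = y" using h(5) by (auto simp: W_def)
          then show "y \<in> h ` W" using hW y by blast
        qed
      qed
      ultimately show ?thesis
        unfolding W.isometry_def bij_betw_def using h by (auto simp: W_def)
    qed
    ultimately obtain ws where ws: "W.reflection_factorization h ws"
      using less.hyps W_nondeg by blast
    have "reflection_factorization f (rev us @ ws)"
      unfolding reflection_factorization_iff
    proof (intro conjI ballI)
      show "u \<in> V" "\<Psi> u u \<noteq> 0" if "u \<in> set (rev us @ ws)" for u
        using that us(1) ws unfolding W.reflection_factorization_iff by (auto simp: W_def)
      fix x assume x: "x \<in> V"
      from orthogonal_decomposition[OF v this] obtain c z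
        where z: "z \<in> V" "\<Psi> z v = 0" "x = c *s v + z" by blast
      have "h x = c *s v + h z"
        using z v hv h(2)[of "c *s v" z] h(3)[of v c] by (simp add: scale_in_V)
      also have "h z = reflection_product ws z"
        using ws z unfolding W.reflection_factorization_iff by (simp add: W_def)
      also have "c *s v + reflection_product ws z = reflection_product ws x"
        unfolding z(3) using ws z v unfolding W.reflection_factorization_iff
        by (intro reflection_product_fixes_orthogonal[symmetric]) (auto simp: W_def)
      finally have "reflection_product us (f x) = reflection_product ws x" by (simp add: h_def)
      then show "f x = reflection_product (rev us @ ws) x"
        using reflection_product_rev[OF us(1) f(1)[OF x]] by simp
    qed
    then show ?thesis by blast
  qed
qed

section \<open>Isometries with prescribed characteristic polynomial\<close>

lemma poly_char_poly_eq_det: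
  fixes G :: "'a::field mat"
  assumes G: "G \<in> carrier_mat n n"
  shows "poly (char_poly G) k = det (k \<cdot>\<^sub>m 1\<^sub>m n - G)"
  unfolding char_poly_def
  by (rule poly_det_cong[of _ n]) (use G in \<open>auto simp: char_poly_matrix_def\<close>)

lemma poly_char_poly_minus_one:
  fixes G :: "'a::field mat"
  assumes G: "G \<in> carrier_mat n n"
  shows "poly (char_poly G) (- 1) = (- 1) ^ n * det (1\<^sub>m n + G)"
proof -
  have "(- 1) \<cdot>\<^sub>m 1\<^sub>m n - G = (- 1) \<cdot>\<^sub>m (1\<^sub>m n + G)"
    using G by (intro eq_matI) auto
  then show ?thesis using G by (simp add: poly_char_poly_eq_det det_smult)
qed

text \<open>
  Multiplication by \<open>T\<close> modulo the monic polynomial \<open>p\<close> of degree \<open>d\<close>, in the basis \<open>1, T, \<dots>, T^(d-1)\<close>.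
\<close>

definition companion_mat :: "'a::comm_ring_1 poly \<Rightarrow> nat \<Rightarrow> 'a mat" where
  "companion_mat p d = mat d d (\<lambda>(i,j).
     if Suc j = d then - coeff p i else if i = Suc j then 1 else 0)"

text \<open>
  The row vector \<open>(1, T, \<dots>, T^(d-1))\<close> times \<open>T - C\<close> is \<open>(0, \<dots>, 0, p)\<close>. Replacing the first row of
  \<open>T - C\<close> by this combination does not change the determinant, and expansion along the new row leaves
  a triangular minor with diagonal \<open>-1\<close>.
\<close>

lemma char_poly_companion_mat:
  fixes p :: "'a::field poly"
  assumes p: "monic p" and d: "degree p = d" "0 < d"
  shows "char_poly (companion_mat p d) = p"
proof -
  let ?C = "companion_mat p d"
  define X where "X = char_poly_matrix ?C"
  \<comment> \<open>multiplication by \<open>E\<close> replaces the first row by the combination with coefficients \<open>T^j\<close>\<close>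
  define E where "E = mat d d (\<lambda>(i,j). if i = 0 then monom (1::'a) j else if i = j then 1 else 0)"
  define Y where "Y = mat d d (\<lambda>(i,j). if i = 0 then (if Suc j = d then p else 0) else X $$ (i,j))"
  obtain l where l: "d = Suc l" using d(2) by (cases d) auto
  have C: "?C \<in> carrier_mat d d" by (simp add: companion_mat_def)
  have car: "X \<in> carrier_mat d d" "E \<in> carrier_mat d d" "Y \<in> carrier_mat d d"
    using C by (auto simp: X_def E_def Y_def)
  have X_ent: "X $$ (i,j) = (if i = j then monom 1 1 else 0)
      + (if Suc j = d then [:coeff p i:] else if i = Suc j then - 1 else 0)" if "i < d" "j < d" for i j
    using that C by (auto simp: X_def char_poly_matrix_def companion_mat_def monom_Suc one_pCons)
  have "E * X = Y"
  proof (rule eq_matI)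
    fix i j assume "i < dim_row Y" "j < dim_col Y"
    then have ij: "i < d" "j < d" using car by auto
    have prod: "(E * X) $$ (i,j) = (\<Sum>k<d. E $$ (i,k) * X $$ (k,j))"
      using ij car by (simp add: scalar_prod_def atLeast0LessThan)
    consider "0 < i" | "i = 0" "Suc j < d" | "i = 0" "Suc j = d" using ij by linarith
    then show "(E * X) $$ (i,j) = Y $$ (i,j)"
    proof cases
      case 1
      have "(\<Sum>k<d. E $$ (i,k) * X $$ (k,j)) = (\<Sum>k<d. if k = i then X $$ (i,j) else 0)"
        using 1 ij by (intro sum.cong) (auto simp: E_def)
      then show ?thesis unfolding prod using 1 ij by (simp add: Y_def)
    next
      case 2
      have "(\<Sum>k<d. E $$ (i,k) * X $$ (k,j))
          = (\<Sum>k<d. (if k = j then monom 1 (Suc j) else 0) + (if k = Suc j then - monom 1 (Suc j) else 0))"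
        using 2 ij by (intro sum.cong) (auto simp: E_def X_ent mult_monom)
      also have "\<dots> = 0" using 2 ij by (simp add: sum.distrib)
      finally show ?thesis unfolding prod using 2 ij by (simp add: Y_def)
    next
      case 3
      have "(\<Sum>k<d. E $$ (i,k) * X $$ (k,j))
          = (\<Sum>k<d. monom (coeff p k) k + (if k = j then monom 1 d else 0))"
        using 3 ij by (intro sum.cong)
          (auto simp: E_def X_ent mult_monom distrib_left monom_0[symmetric])
      also have "\<dots> = (\<Sum>k<d. monom (coeff p k) k) + monom (coeff p d) d"
        using 3 ij p d by (simp add: sum.distrib)
      also have "\<dots> = (\<Sum>k\<le>d. monom (coeff p k) k)"
        by (simp add: lessThan_Suc_atMost[symmetric])
      also have "\<dots> = p" using poly_as_sum_of_monoms[of p] d by simp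
      finally show ?thesis unfolding prod using 3 ij by (simp add: Y_def)
    qed
  qed (use car in auto)
  moreover have "det E = 1"
  proof -
    have "det E = prod_list (diag_mat E)"
      by (rule det_upper_triangular[OF _ car(2)]) (auto simp: E_def)
    also have "diag_mat E = replicate d 1"
      by (rule nth_equalityI) (auto simp: diag_mat_def E_def monom_0 one_pCons)
    finally show ?thesis by simp
  qed
  ultimately have "det X = det Y" using det_mult[OF car(2,1)] by simp
  also have "det Y = (\<Sum>j<d. Y $$ (0,j) * cofactor Y 0 j)"
    using d by (intro laplace_expansion_row[OF car(3)])
  also have "\<dots> = (\<Sum>j<d. if j = l then p * cofactor Y 0 l else 0)"
    using l by (intro sum.cong) (auto simp: Y_def)
  also have "\<dots> = p * cofactor Y 0 l" using l by simp
  also have "cofactor Y 0 l = 1"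
  proof -
    let ?M = "mat_delete Y 0 l"
    have M: "?M \<in> carrier_mat l l" using mat_delete_carrier[OF car(3), of 0 l] l by simp
    have M_ent: "?M $$ (i,j) = X $$ (Suc i, j)" if "i < l" "j < l" for i j
      using that car l by (auto simp: mat_delete_def Y_def)
    have "det ?M = prod_list (diag_mat ?M)"
    proof (rule det_upper_triangular[OF _ M], rule upper_triangularI)
      fix i j assume "j < i" "i < dim_row ?M"
      then have "j < i" "i < l" "j < l" using carrier_matD[OF M] by auto
      then show "?M $$ (i,j) = 0" using l by (simp add: M_ent X_ent)
    qed
    also have "diag_mat ?M = replicate l (- 1)"
      using carrier_matD[OF M] l
      by (intro nth_equalityI) (simp_all add: diag_mat_def M_ent X_ent)
    finally show ?thesis by (simp add: cofactor_def power_mult_distrib[symmetric])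
  qed
  finally show ?thesis by (simp add: char_poly_def X_def)
qed

text \<open>
  The matrix form of an isometry of a non-degenerate space: \<open>A\<close> is the Gram matrix, \<open>G\<close> the isometry.
\<close>

definition isometry_mat :: "nat \<Rightarrow> 'a::field mat \<Rightarrow> 'a mat \<Rightarrow> bool" where
  "isometry_mat n A G \<longleftrightarrow> A \<in> carrier_mat n n \<and> G \<in> carrier_mat n n
     \<and> A\<^sup>T = A \<and> det A \<noteq> 0 \<and> G\<^sup>T * A * G = A"

text \<open>
  An isometry \<open>G\<close> of an alternating form \<open>J\<close> commutes with \<open>G - G\<inverse>\<close>, which is skew-adjoint for \<open>J\<close>;
  so \<open>J (G - G\<inverse>)\<close> is a symmetric form preserved by \<open>G\<close>. As \<open>J G\<inverse> = G\<^sup>T J\<close>, it can be written without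
  an inverse. Multiplied by \<open>G\<close> it becomes \<open>J (G - 1) (G + 1)\<close>, so it is non-degenerate
  exactly when \<open>1\<close> and \<open>-1\<close> are not eigenvalues of \<open>G\<close>.
\<close>

lemma isometry_mat_of_alternating:
  fixes J G :: "'a::field mat"
  assumes car: "J \<in> carrier_mat n n" "G \<in> carrier_mat n n"
    and J_skew: "J\<^sup>T = - J" and J_det: "det J \<noteq> 0" and G_J: "G\<^sup>T * J * G = J"
    and G_one: "det (1\<^sub>m n - G) \<noteq> 0" and G_minus_one: "det (1\<^sub>m n + G) \<noteq> 0"
  shows "isometry_mat n (J * G - G\<^sup>T * J) G"
proof -
  let ?A = "J * G - G\<^sup>T * J"
  have JG: "J * G \<in> carrier_mat n n" "G\<^sup>T * J \<in> carrier_mat n n" "G\<^sup>T \<in> carrier_mat n n"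
    "J * G * G \<in> carrier_mat n n" "G * G \<in> carrier_mat n n" using car by auto
  have AG: "?A * G = J * G * G - J"
    using car JG by (simp add: minus_mult_distrib_mat[of _ n n] G_J)
  have "?A\<^sup>T = ?A"
  proof -
    have "?A\<^sup>T = (J * G)\<^sup>T - (G\<^sup>T * J)\<^sup>T"
      using JG by (intro transpose_minus) auto
    also have "(J * G)\<^sup>T = G\<^sup>T * (- J)" using car J_skew by (simp add: transpose_mult[of _ n n _ n])
    also have "(G\<^sup>T * J)\<^sup>T = (- J) * G" using car JG J_skew by (simp add: transpose_mult[of _ n n _ n])
    also have "G\<^sup>T * (- J) - (- J) * G = ?A"
      using car JG by (simp add: uminus_mult_left_mat uminus_mult_right_mat) (intro eq_matI, auto)
    finally show ?thesis .
  qed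
  moreover have "G\<^sup>T * ?A * G = ?A"
  proof -
    have "G\<^sup>T * ?A * G = G\<^sup>T * (?A * G)"
      using car JG by (intro assoc_mult_mat[of _ n n _ n _ n]) auto
    also have "\<dots> = G\<^sup>T * (J * G * G - J)" by (simp only: AG)
    also have "\<dots> = G\<^sup>T * (J * G * G) - G\<^sup>T * J"
      using car JG by (simp add: mult_minus_distrib_mat[of _ n n _ n])
    also have "G\<^sup>T * (J * G * G) = (G\<^sup>T * J * G) * G"
      using car JG by (simp add: assoc_mult_mat[of _ n n _ n _ n])
    finally show ?thesis by (simp add: G_J)
  qed
  moreover have "det ?A \<noteq> 0"
  proof
    assume A0: "det ?A = 0"
    have "?A * G = J * ((- 1) \<cdot>\<^sub>m ((1\<^sub>m n - G) * (1\<^sub>m n + G)))"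
    proof -
      have "(1\<^sub>m n - G) * (1\<^sub>m n + G) = 1\<^sub>m n - G * G"
      proof -
        have "(1\<^sub>m n - G) * (1\<^sub>m n + G) = 1\<^sub>m n * (1\<^sub>m n + G) - G * (1\<^sub>m n + G)"
          using car by (intro minus_mult_distrib_mat) auto
        also have "G * (1\<^sub>m n + G) = G + G * G"
          using car by (subst mult_add_distrib_mat[of _ n n]) auto
        also have "1\<^sub>m n * (1\<^sub>m n + G) - (G + G * G) = 1\<^sub>m n - G * G"
          using car JG by (intro eq_matI) auto
        finally show ?thesis .
      qed
      moreover have "(- 1) \<cdot>\<^sub>m (1\<^sub>m n - G * G) = G * G - 1\<^sub>m n"
        using car JG by (intro eq_matI) auto
      moreover have "J * (G * G - 1\<^sub>m n) = J * G * G - J"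
        using car JG by (simp add: mult_minus_distrib_mat[of _ n n _ n] assoc_mult_mat[of _ n n _ n _ n])
      ultimately show ?thesis by (simp add: AG)
    qed
    moreover have "det (?A * G) = det ?A * det G"
      using car JG by (intro det_mult[of _ n]) auto
    moreover have "det (J * ((- 1) \<cdot>\<^sub>m ((1\<^sub>m n - G) * (1\<^sub>m n + G))))
        = det J * ((- 1) ^ n * (det (1\<^sub>m n - G) * det (1\<^sub>m n + G)))"
    proof -
      have "det (J * ((- 1) \<cdot>\<^sub>m ((1\<^sub>m n - G) * (1\<^sub>m n + G))))
          = det J * det ((- 1) \<cdot>\<^sub>m ((1\<^sub>m n - G) * (1\<^sub>m n + G)))"
        using car by (intro det_mult[of _ n]) auto
      also have "det ((- 1) \<cdot>\<^sub>m ((1\<^sub>m n - G) * (1\<^sub>m n + G)))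
          = (- 1) ^ n * det ((1\<^sub>m n - G) * (1\<^sub>m n + G))"
        using car by (simp add: det_smult)
      also have "det ((1\<^sub>m n - G) * (1\<^sub>m n + G)) = det (1\<^sub>m n - G) * det (1\<^sub>m n + G)"
        using car by (intro det_mult[of _ n]) auto
      finally show ?thesis .
    qed
    ultimately show False using A0 J_det G_one G_minus_one by simp
  qed
  ultimately show ?thesis
    using car JG unfolding isometry_mat_def by auto
qed

text \<open>
  The coefficients \<open>s\<close> of the power series \<open>T^n / p\<close>. Extended to negative indices by
  \<open>s\<^sub>-\<^sub>k = - s\<^sub>k\<close>, they satisfy the linear recurrence with characteristic polynomial \<open>p\<close> on both sides
  of zero: the terms of negative index and, by the symmetry of \<open>p\<close>, also those of positive index
  add up to a coefficient of \<open>p \<cdot> (T^n / p) = T^n\<close>, and the two contributions cancel. The recurrence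
  is stated with the terms of negative index moved to the right-hand side.
\<close>

lemma odd_recurrence_exists:
  fixes p :: "'a::field poly"
  assumes deg: "degree p = 2 * n" and palindrome: "\<And>i. i \<le> 2 * n \<Longrightarrow> coeff p (2 * n - i) = coeff p i"
    and monic: "monic p"
  obtains s where "\<And>k. k < n \<Longrightarrow> s k = 0" and "s n = (1::'a)"
    and "\<And>m. m \<le> 2 * n \<Longrightarrow> (\<Sum>j\<in>{m..2*n}. coeff p j * s (j - m)) = (\<Sum>j\<le>m. coeff p j * s (m - j))"
proof -
  define P where "P = Abs_fps (coeff p)"
  have P0: "fps_nth P 0 = 1" using palindrome[of 0] monic deg by (simp add: P_def)
  define S where "S = fps_X ^ n * inverse P"
  have PS: "P * S = fps_X ^ n"
    using inverse_mult_eq_1[of P] P0 by (simp add: S_def ac_simps)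
  have conv: "(\<Sum>j\<le>m. coeff p j * fps_nth S (m - j)) = (if m = n then 1 else 0)" for m
  proof -
    have "(\<Sum>j\<le>m. coeff p j * fps_nth S (m - j)) = fps_nth (P * S) m"
      by (simp add: fps_mult_nth P_def atMost_atLeast0)
    then show ?thesis by (simp add: PS fps_X_power_nth)
  qed
  show ?thesis
  proof (rule that[of "fps_nth S"])
    show "fps_nth S k = 0" if "k < n" for k
      using that by (simp add: S_def fps_X_power_mult_nth)
    show "fps_nth S n = 1"
      using P0 by (simp add: S_def fps_X_power_mult_nth)
    fix m assume m: "m \<le> 2 * n"
    have "(\<Sum>j\<in>{m..2*n}. coeff p j * fps_nth S (j - m))
        = (\<Sum>l\<le>2*n - m. coeff p l * fps_nth S (2*n - m - l))"
    proof (rule sum.reindex_bij_witness[of _ "\<lambda>l. 2*n - l" "\<lambda>j. 2*n - j"])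
      fix j assume j: "j \<in> {m..2*n}"
      then have "2 * n - m - (2 * n - j) = j - m" by auto
      then show "coeff p (2*n - j) * fps_nth S (2*n - m - (2*n - j)) = coeff p j * fps_nth S (j - m)"
        using j palindrome by simp
    qed (use m in auto)
    then show "(\<Sum>j\<in>{m..2*n}. coeff p j * fps_nth S (j - m)) = (\<Sum>j\<le>m. coeff p j * fps_nth S (m - j))"
      unfolding conv using m by auto
  qed
qed

text \<open>
  The form is the Toeplitz matrix \<open>t i j = s (j - i)\<close> of the odd sequence \<open>s\<close> of
  \<open>odd_recurrence_exists\<close>. Multiplication by \<open>T\<close> shifts both indices by one and thus preserves a
  Toeplitz form; in the last basis vector, where \<open>T^(2n)\<close> is reduced modulo \<open>p\<close>, this is the
  recurrence. As \<open>s\<close> vanishes below index \<open>n\<close>, the form consists of two triangular blocks off the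
  diagonal.
\<close>

lemma companion_alternating_form:
  fixes p :: "'a::field poly"
  assumes monic: "monic p" and deg: "degree p = 2 * n" and n: "0 < n"
    and palindrome: "\<And>i. i \<le> 2 * n \<Longrightarrow> coeff p (2 * n - i) = coeff p i"
  obtains J where "J \<in> carrier_mat (2 * n) (2 * n)" and "J\<^sup>T = - J" and "det J \<noteq> 0"
    and "(companion_mat p (2 * n))\<^sup>T * J * companion_mat p (2 * n) = J"
proof -
  let ?d = "2 * n"
  obtain s :: "nat \<Rightarrow> 'a" where s0: "\<And>k. k < n \<Longrightarrow> s k = 0" and sn: "s n = 1"
    and rec: "\<And>m. m \<le> ?d \<Longrightarrow> (\<Sum>j\<in>{m..?d}. coeff p j * s (j - m)) = (\<Sum>j\<le>m. coeff p j * s (m - j))"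
    using odd_recurrence_exists[OF deg palindrome monic] by metis
  define t where "t i j = (if i \<le> j then s (j - i) else - s (i - j))" for i j
  have t_skew: "t j i = - t i j" for i j
    using s0[OF n] by (auto simp: t_def)
  have t_shift: "t (Suc i) (Suc j) = t i j" for i j by (simp add: t_def)
  \<comment> \<open>the recurrence, solved for the term with the leading coefficient of \<open>p\<close>\<close>
  have t_rec: "(\<Sum>k<?d. coeff p k * t m k) = - t m ?d" if m: "m \<le> ?d" for m
  proof -
    have "(\<Sum>k\<le>?d. coeff p k * t m k)
        = (\<Sum>k\<in>{m..?d}. coeff p k * s (k - m)) + (\<Sum>k<m. - (coeff p k * s (m - k)))"
    proof -
      have split: "{..?d} = {m..?d} \<union> {..<m}" using m by auto
      have "(\<Sum>k\<le>?d. coeff p k * t m k)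
          = (\<Sum>k\<in>{m..?d}. coeff p k * t m k) + (\<Sum>k<m. coeff p k * t m k)"
        unfolding split by (rule sum.union_disjoint) auto
      also have "(\<Sum>k\<in>{m..?d}. coeff p k * t m k) = (\<Sum>k\<in>{m..?d}. coeff p k * s (k - m))"
        by (intro sum.cong) (auto simp: t_def)
      also have "(\<Sum>k<m. coeff p k * t m k) = (\<Sum>k<m. - (coeff p k * s (m - k)))"
        by (intro sum.cong) (auto simp: t_def)
      finally show ?thesis .
    qed
    also have "(\<Sum>k<m. - (coeff p k * s (m - k))) = - (\<Sum>k\<le>m. coeff p k * s (m - k))"
      using s0[OF n] by (simp add: sum_negf lessThan_Suc_atMost[symmetric])
    finally have "(\<Sum>k\<le>?d. coeff p k * t m k) = 0" using rec[OF m] by simp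
    moreover have "(\<Sum>k\<le>?d. coeff p k * t m k) = (\<Sum>k<?d. coeff p k * t m k) + t m ?d"
      using monic deg by (simp add: lessThan_Suc_atMost[symmetric])
    ultimately show ?thesis by (simp add: eq_neg_iff_add_eq_0)
  qed
  define J where "J = mat ?d ?d (\<lambda>(i,j). t i j)"
  define C where "C = companion_mat p ?d"
  have car: "J \<in> carrier_mat ?d ?d" "C \<in> carrier_mat ?d ?d"
    by (simp_all add: J_def C_def companion_mat_def)
  \<comment> \<open>the companion matrix shifts a sequence that satisfies the recurrence\<close>
  have C_sum: "(\<Sum>k<?d. a k * C $$ (k,j)) = a (Suc j)"
    if j: "j < ?d" and a: "(\<Sum>k<?d. coeff p k * a k) = - a ?d" for a j
  proof (cases "Suc j = ?d")
    case True
    have "(\<Sum>k<?d. a k * C $$ (k,j)) = (\<Sum>k<?d. - (coeff p k * a k))"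
      using True j by (intro sum.cong) (auto simp: C_def companion_mat_def)
    also have "\<dots> = a (Suc j)" using a by (simp add: sum_negf True)
    finally show ?thesis .
  next
    case False
    have "(\<Sum>k<?d. a k * C $$ (k,j)) = (\<Sum>k<?d. if k = Suc j then a k else 0)"
      using False j by (intro sum.cong) (auto simp: C_def companion_mat_def)
    also have "\<dots> = a (Suc j)" using False j by simp
    finally show ?thesis .
  qed
  have JC: "(J * C) $$ (i,j) = t i (Suc j)" if "i < ?d" "j < ?d" for i j
  proof -
    have "(J * C) $$ (i,j) = (\<Sum>k<?d. t i k * C $$ (k,j))"
      using that car by (simp add: scalar_prod_def atLeast0LessThan J_def)
    also have "\<dots> = t i (Suc j)" using that t_rec[of i] by (intro C_sum) auto
    finally show ?thesis .
  qed
  have "C\<^sup>T * (J * C) = J"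
  proof (rule eq_matI)
    fix i j assume "i < dim_row J" "j < dim_col J"
    then have ij: "i < ?d" "j < ?d" using car by auto
    have "(C\<^sup>T * (J * C)) $$ (i,j) = (\<Sum>k<?d. t k (Suc j) * C $$ (k,i))"
    proof -
      define L where "L = J * C"
      have "L \<in> carrier_mat ?d ?d" using car by (simp add: L_def)
      then have "(C\<^sup>T * L) $$ (i,j) = (\<Sum>k<?d. C $$ (k,i) * L $$ (k,j))"
        using ij car by (simp add: scalar_prod_def atLeast0LessThan)
      then show ?thesis using ij by (simp add: L_def JC mult.commute[of "C $$ _"])
    qed
    also have "\<dots> = t (Suc i) (Suc j)"
    proof (rule C_sum[OF ij(1)])
      have "(\<Sum>k<?d. coeff p k * t k (Suc j)) = - (\<Sum>k<?d. coeff p k * t (Suc j) k)"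
        by (simp add: sum_negf[symmetric] t_skew[of "Suc j"])
      also have "\<dots> = - t ?d (Suc j)"
        using t_rec[of "Suc j"] ij by (simp add: t_skew[of "Suc j" ?d])
      finally show "(\<Sum>k<?d. coeff p k * t k (Suc j)) = - t ?d (Suc j)" .
    qed
    finally show "(C\<^sup>T * (J * C)) $$ (i,j) = J $$ (i,j)" using ij by (simp add: t_shift J_def)
  qed (use car in auto)
  then have "C\<^sup>T * J * C = J"
    using car by (simp add: assoc_mult_mat[of _ ?d ?d _ ?d _ ?d])
  moreover have "J\<^sup>T = - J"
  proof (rule eq_matI)
    fix i j assume "i < dim_row (- J)" "j < dim_col (- J)"
    then show "J\<^sup>T $$ (i,j) = (- J) $$ (i,j)" using t_skew[of j i] by (simp add: J_def)
  qed (use car in auto)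
  moreover have "det J \<noteq> 0"
  proof -
    define X where "X = mat n n (\<lambda>(i,j). t i (j + n))"
    define Y where "Y = mat n n (\<lambda>(i,j). t (i + n) j)"
    have XY: "X \<in> carrier_mat n n" "Y \<in> carrier_mat n n" by (simp_all add: X_def Y_def)
    \<comment> \<open>entries with \<open>\<bar>i - j\<bar> < n\<close> vanish, which empties both diagonal blocks\<close>
    have "J = four_block_mat (0\<^sub>m n n) X Y (0\<^sub>m n n)"
      using s0 by (intro eq_matI) (auto simp: J_def X_def Y_def t_def)
    then have "det J = det (0\<^sub>m n n * 0\<^sub>m n n - X * Y)"
      using det_four_block_mat[of "0\<^sub>m n n" n X Y "0\<^sub>m n n"] XY by simp
    also have "0\<^sub>m n n * 0\<^sub>m n n - X * Y = (- 1) \<cdot>\<^sub>m (X * Y)"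
      using XY by (intro eq_matI) auto
    also have "det \<dots> = (- 1) ^ n * (det X * det Y)"
      using XY by (simp add: det_smult det_mult[OF XY])
    also have "det X = 1"
    proof -
      have "det X = prod_list (diag_mat X)"
        by (rule det_upper_triangular[OF _ XY(1)]) (auto simp: X_def t_def s0)
      also have "diag_mat X = replicate n 1"
        by (rule nth_equalityI) (auto simp: diag_mat_def X_def t_def sn)
      finally show ?thesis by simp
    qed
    also have "det Y = (- 1) ^ n"
    proof -
      have "det Y = prod_list (diag_mat Y)"
        using n by (intro det_lower_triangular[OF _ XY(2)]) (auto simp: Y_def t_def s0)
      also have "diag_mat Y = replicate n (- 1)"
        using n by (intro nth_equalityI) (auto simp: diag_mat_def Y_def t_def sn)
      finally show ?thesis by simp
    qed
    finally show ?thesis by simp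
  qed
  ultimately show ?thesis using that[of J] car by (simp add: C_def)
qed

lemma isometry_mat_companion:
  fixes p :: "'a::field poly"
  assumes monic: "monic p" and deg: "degree p = 2 * n"
    and palindrome: "\<And>i. i \<le> 2 * n \<Longrightarrow> coeff p (2 * n - i) = coeff p i"
    and roots: "poly p 1 \<noteq> 0" "poly p (- 1) \<noteq> 0"
  shows "\<exists>A G. isometry_mat (2 * n) A G \<and> char_poly G = p"
proof (cases "n = 0")
  case True
  then have "p = 1" using monic deg by (metis monic_degree_0 mult_0_right)
  moreover have "isometry_mat 0 (1\<^sub>m 0) (1\<^sub>m 0 :: 'a mat)"
    by (simp add: isometry_mat_def)
  moreover have "char_poly (1\<^sub>m 0 :: 'a mat) = 1"
    unfolding char_poly_def by (rule det_dim_zero) (simp add: char_poly_matrix_def)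
  ultimately show ?thesis using True by (metis mult_0_right)
next
  case False
  let ?G = "companion_mat p (2 * n)"
  have G: "?G \<in> carrier_mat (2 * n) (2 * n)" by (simp add: companion_mat_def)
  have cp: "char_poly ?G = p" using char_poly_companion_mat[OF monic deg] False by simp
  obtain J where J: "J \<in> carrier_mat (2 * n) (2 * n)" "J\<^sup>T = - J" "det J \<noteq> 0" "?G\<^sup>T * J * ?G = J"
    using companion_alternating_form[OF monic deg _ palindrome] False by blast
  have "1 \<cdot>\<^sub>m 1\<^sub>m (2 * n) = (1\<^sub>m (2 * n) :: 'a mat)" by (intro eq_matI) auto
  then have "det (1\<^sub>m (2 * n) - ?G) \<noteq> 0" "det (1\<^sub>m (2 * n) + ?G) \<noteq> 0"
    using poly_char_poly_eq_det[OF G, of 1] poly_char_poly_minus_one[OF G] roots by (auto simp: cp)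
  then show ?thesis using isometry_mat_of_alternating[OF J(1) G J(2-4)] cp by blast
qed

text \<open>
  Orthogonal sum with a line whose generator has norm \<open>a\<close> and eigenvalue \<open>e\<close>.
\<close>

lemma isometry_mat_extend:
  fixes A G :: "'a::field mat"
  assumes AG: "isometry_mat n A G" and a: "a \<noteq> 0" and e: "e * e = 1"
  shows "isometry_mat (Suc n) (four_block_mat A (0\<^sub>m n 1) (0\<^sub>m 1 n) (mat 1 1 (\<lambda>_. a)))
      (four_block_mat G (0\<^sub>m n 1) (0\<^sub>m 1 n) (mat 1 1 (\<lambda>_. e)))"
    and "char_poly (four_block_mat G (0\<^sub>m n 1) (0\<^sub>m 1 n) (mat 1 1 (\<lambda>_. e)))
      = char_poly G * [:- e, 1:]"
proof -
  let ?b = "\<lambda>X x. four_block_mat X (0\<^sub>m n 1) (0\<^sub>m 1 n) (mat 1 1 (\<lambda>_. x :: 'a))"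
  have A: "A \<in> carrier_mat n n" and G: "G \<in> carrier_mat n n"
    and sym: "A\<^sup>T = A" and det0: "det A \<noteq> 0" and pres: "G\<^sup>T * A * G = A"
    using AG by (auto simp: isometry_mat_def)
  have mult: "?b X x * ?b Y y = ?b (X * Y) (x * y)"
    if "X \<in> carrier_mat n n" "Y \<in> carrier_mat n n" for X Y x y
  proof -
    have "mat 1 1 (\<lambda>_. x) * mat 1 1 (\<lambda>_. y) = mat 1 1 (\<lambda>_. x * y)"
      by (intro eq_matI) (auto simp: scalar_prod_def)
    then show ?thesis
      using that
      by (subst mult_four_block_mat[where ?nr1.0 = n and ?n1.0 = n and ?n2.0 = 1 and ?nr2.0 = 1
          and ?nc1.0 = n and ?nc2.0 = 1]) auto
  qed
  have car: "?b X x \<in> carrier_mat (Suc n) (Suc n)" if "X \<in> carrier_mat n n" for X x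
    using that by (intro carrier_matI) auto
  have transp: "(?b X x)\<^sup>T = ?b (X\<^sup>T) x" if "X \<in> carrier_mat n n" for X x
    using that by (intro eq_matI) auto
  have "det (?b A a) = det A * det (mat 1 1 (\<lambda>_. a))"
    using A by (intro det_four_block_mat_lower_left_zero) auto
  also have "det (mat 1 1 (\<lambda>_. a)) = a" by (subst det_single) auto
  finally have "det (?b A a) \<noteq> 0" using det0 a by simp
  moreover have "(?b G e)\<^sup>T * ?b A a * ?b G e = ?b A a"
  proof -
    have "G\<^sup>T \<in> carrier_mat n n" "G\<^sup>T * A \<in> carrier_mat n n" using A G by auto
    moreover have "e * a * e = a" using e by (metis mult.assoc mult.commute mult_1_right)
    ultimately show ?thesis using A G by (simp only: transp mult pres)
  qed
  ultimately show "isometry_mat (Suc n) (?b A a) (?b G e)"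
    using car[OF A] car[OF G] transp[OF A] sym unfolding isometry_mat_def by presburger
  have "char_poly_matrix (?b G e)
      = four_block_mat (char_poly_matrix G) (0\<^sub>m n 1) (0\<^sub>m 1 n) (mat 1 1 (\<lambda>_. [:- e, 1:]))"
    using G by (intro eq_matI) (auto simp: char_poly_matrix_def)
  then have "char_poly (?b G e) = det (four_block_mat (char_poly_matrix G) (0\<^sub>m n 1) (0\<^sub>m 1 n)
      (mat 1 1 (\<lambda>_. [:- e, 1:])))"
    by (simp add: char_poly_def)
  also have "\<dots> = det (char_poly_matrix G) * det (mat 1 1 (\<lambda>_. [:- e, 1:]))"
    using G by (intro det_four_block_mat_lower_left_zero) auto
  also have "det (mat 1 1 (\<lambda>_. [:- e, 1:])) = [:- e, 1:]" by (subst det_single) auto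
  finally show "char_poly (?b G e) = char_poly G * [:- e, 1:]" by (simp add: char_poly_def)
qed

lemma isometry_mat_exists:
  fixes p :: "'a::field poly"
  assumes "monic p" and "reciprocal p" and "even (degree p)"
    and roots: "poly p 1 \<noteq> 0" "poly p (- 1) \<noteq> 0"
  shows "\<exists>A G. isometry_mat (a + b + degree p) A G
    \<and> char_poly G = [:- 1, 1:] ^ a * [:1, 1:] ^ b * p"
proof (induction a)
  case 0
  show ?case
  proof (induction b)
    case 0
    obtain n where n: "degree p = 2 * n" using assms(3) by blast
    have "coeff p (2 * n - i) = coeff p i" if "i \<le> 2 * n" for i
      using coeff_reflect_poly[of p i] assms(2) that n by (simp add: reciprocal_def)
    from isometry_mat_companion[OF assms(1) n this roots] show ?case by (simp add: n)
  next
    case (Suc b)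
    then obtain A G where AG: "isometry_mat (0 + b + degree p) A G"
      "char_poly G = [:- 1, 1:] ^ 0 * [:1, 1:] ^ b * p" by blast
    from isometry_mat_extend[OF AG(1), of 1 "- 1"] AG(2) show ?case
      by (auto simp: algebra_simps simp del: mult_pCons_left mult_pCons_right)
  qed
next
  case (Suc a)
  then obtain A G where AG: "isometry_mat (a + b + degree p) A G"
    "char_poly G = [:- 1, 1:] ^ a * [:1, 1:] ^ b * p" by blast
  from isometry_mat_extend[OF AG(1), of 1 1] AG(2) show ?case
    by (auto simp: algebra_simps simp del: mult_pCons_left mult_pCons_right)
qed

section \<open>Matrices acting on sequences\<close>

text \<open>
  The copy of \<open>k^n\<close> in the space of sequences, with the form of Gram matrix \<open>A\<close>, the endomorphism of
  matrix \<open>G\<close> and the standard basis. These spaces are nested, which makes it easy to pass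
  from \<open>k^n\<close> to its orthogonal sum with a line.
\<close>

definition seq_space :: "nat \<Rightarrow> (nat \<Rightarrow> 'k::field) set" where
  "seq_space n = {x. \<forall>i\<ge>n. x i = 0}"

definition seq_form :: "'k::field mat \<Rightarrow> nat \<Rightarrow> (nat \<Rightarrow> 'k) \<Rightarrow> (nat \<Rightarrow> 'k) \<Rightarrow> 'k" where
  "seq_form A n x y = vec n x \<bullet> (A *\<^sub>v vec n y)"

definition seq_map :: "'k::field mat \<Rightarrow> nat \<Rightarrow> (nat \<Rightarrow> 'k) \<Rightarrow> nat \<Rightarrow> 'k" where
  "seq_map G n x = (\<lambda>i. if i < n then (G *\<^sub>v vec n x) $ i else 0)"

definition seq_unit :: "nat \<Rightarrow> nat \<Rightarrow> 'k::field" where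
  "seq_unit i = (\<lambda>k. if k = i then 1 else 0)"

interpretation seq: vector_space seq_scale
  by (rule vector_space_seq_scale)

lemma sum_fun_apply: "(\<Sum>i\<in>I. f i) k = (\<Sum>i\<in>I. f i k)" for f :: "'a \<Rightarrow> 'b \<Rightarrow> 'c::comm_monoid_add"
  by (induction I rule: infinite_finite_induct) auto

lemma vec_seq [simp]:
  "vec n (x + y) = vec n x + vec n y"
  "vec n (seq_scale c x) = c \<cdot>\<^sub>v vec n x"
  by (auto simp: seq_scale_def)

lemma vec_seq_map: "G \<in> carrier_mat n n \<Longrightarrow> vec n (seq_map G n x) = G *\<^sub>v vec n x"
  by (auto simp: seq_map_def)

lemma subspace_seq_space: "seq.subspace (seq_space n)"
  by (auto simp: seq.subspace_def seq_space_def seq_scale_def)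

lemma seq_space_expansion:
  assumes "x \<in> seq_space n"
  shows "x = (\<Sum>i<n. seq_scale (x i) (seq_unit i))"
proof
  fix k
  have "(\<Sum>i<n. seq_scale (x i) (seq_unit i)) k = (\<Sum>i<n. if i = k then x i else 0)"
    unfolding sum_fun_apply by (intro sum.cong) (auto simp: seq_scale_def seq_unit_def)
  then show "x k = (\<Sum>i<n. seq_scale (x i) (seq_unit i)) k"
    using assms by (auto simp: seq_space_def)
qed

lemma span_seq_unit: "seq.span (seq_unit ` {..<n}) = (seq_space n :: (nat \<Rightarrow> 'k::field) set)"
proof
  show "seq.span (seq_unit ` {..<n}) \<subseteq> (seq_space n :: (nat \<Rightarrow> 'k) set)"
    by (rule seq.span_minimal[OF _ subspace_seq_space]) (auto simp: seq_space_def seq_unit_def)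
  show "(seq_space n :: (nat \<Rightarrow> 'k) set) \<subseteq> seq.span (seq_unit ` {..<n})"
  proof
    fix x :: "nat \<Rightarrow> 'k" assume "x \<in> seq_space n"
    then have "x = (\<Sum>i<n. seq_scale (x i) (seq_unit i))" by (rule seq_space_expansion)
    also have "\<dots> \<in> seq.span (seq_unit ` {..<n})"
      by (intro seq.span_sum seq.span_scale seq.span_base) auto
    finally show "x \<in> seq.span (seq_unit ` {..<n})" .
  qed
qed

lemma inj_seq_unit: "inj (seq_unit :: nat \<Rightarrow> nat \<Rightarrow> 'k::field)"
  by (rule injI) (metis seq_unit_def zero_neq_one)

lemma independent_seq_unit: "seq.independent (seq_unit ` {..<n} :: (nat \<Rightarrow> 'k::field) set)"
proof
  assume "seq.dependent (seq_unit ` {..<n} :: (nat \<Rightarrow> 'k) set)"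
  then obtain u and v :: "nat \<Rightarrow> 'k" where v: "v \<in> seq_unit ` {..<n}" "u v \<noteq> 0"
    and sum0: "(\<Sum>v\<in>seq_unit ` {..<n}. seq_scale (u v) v) = 0"
    by (auto simp: seq.dependent_finite)
  obtain k where k: "k < n" "v = seq_unit k" using v(1) by auto
  have "(\<Sum>i<n. seq_scale (u (seq_unit i)) (seq_unit i)) k = 0"
    using sum0 by (subst (asm) sum.reindex) (auto intro: inj_on_subset[OF inj_seq_unit])
  moreover have "(\<Sum>i<n. seq_scale (u (seq_unit i)) (seq_unit i)) k
      = (\<Sum>i<n. if i = k then u (seq_unit i) else 0)"
    unfolding sum_fun_apply by (intro sum.cong) (auto simp: seq_scale_def seq_unit_def)
  ultimately show False using v k by simp
qed

lemma seq_form_sum: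
  assumes "A \<in> carrier_mat n n"
  shows "seq_form A n x y = (\<Sum>i<n. x i * (\<Sum>j<n. A $$ (i,j) * y j))"
  using assms by (simp add: seq_form_def scalar_prod_def atLeast0LessThan)

lemma quadratic_space_seq:
  assumes "isometry_mat n A G"
  shows "quadratic_space seq_scale (seq_space n) (seq_form A n)"
proof
  have A: "A \<in> carrier_mat n n" and sym: "A\<^sup>T = A" using assms by (auto simp: isometry_mat_def)
  show "seq.subspace (seq_space n)" by (rule subspace_seq_space)
  show "\<exists>B. finite B \<and> seq_space n = seq.span B"
    by (intro exI[of _ "seq_unit ` {..<n}"] conjI) (simp_all add: span_seq_unit)
  fix x y z :: "nat \<Rightarrow> 'a" and c
  show "seq_form A n (x + y) z = seq_form A n x z + seq_form A n y z"
    using A by (simp add: seq_form_sum distrib_right sum.distrib)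
  show "seq_form A n (seq_scale c x) y = c * seq_form A n x y"
    using A by (simp add: seq_form_sum seq_scale_def sum_distrib_left mult.assoc)
  have "seq_form A n x y = (A\<^sup>T *\<^sub>v vec n x) \<bullet> vec n y"
    using A unfolding seq_form_def by (intro transpose_vec_mult_scalar[symmetric]) auto
  also have "\<dots> = seq_form A n y x"
    using A unfolding seq_form_def sym by (intro comm_scalar_prod[of _ n]) auto
  finally show "seq_form A n x y = seq_form A n y x" .
qed

lemma nondegenerate_seq:
  assumes AG: "isometry_mat n A G"
  shows "nondegenerate_quadratic_space seq_scale (seq_space n) (seq_form A n)"
proof -
  interpret quadratic_space seq_scale "seq_space n" "seq_form A n"
    using AG by (rule quadratic_space_seq)
  have A: "A \<in> carrier_mat n n" and det0: "det A \<noteq> 0" using AG by (auto simp: isometry_mat_def)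
  show ?thesis
  proof
    fix x assume x: "x \<in> seq_space n" and orth: "\<And>y. y \<in> seq_space n \<Longrightarrow> seq_form A n x y = 0"
    \<comment> \<open>pairing with the unit vectors shows that \<open>A x = 0\<close>\<close>
    define w where "w = A *\<^sub>v vec n x"
    have dim_w: "dim_vec w = n" using A by (simp add: w_def)
    have ent: "w $ i = 0" if i: "i < n" for i
    proof -
      have u: "seq_unit i \<in> seq_space n" using i by (auto simp: seq_space_def seq_unit_def)
      have "seq_form A n (seq_unit i) x = (\<Sum>k<n. seq_unit i k * w $ k)"
        using dim_w by (simp add: seq_form_def w_def[symmetric] scalar_prod_def atLeast0LessThan)
      also have "\<dots> = (\<Sum>k<n. if k = i then w $ k else 0)"
        by (intro sum.cong) (auto simp: seq_unit_def)
      also have "\<dots> = w $ i" using i by simp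
      finally show ?thesis using orth[OF u] form_sym[OF u x] by simp
    qed
    have "A *\<^sub>v vec n x = 0\<^sub>v n"
    proof (rule eq_vecI)
      show "(A *\<^sub>v vec n x) $ i = 0\<^sub>v n $ i" if "i < dim_vec (0\<^sub>v n)" for i
        using that ent by (simp add: w_def)
    qed (use A in auto)
    then have "vec n x = 0\<^sub>v n"
      using det0 det_0_iff_vec_prod_zero_field[OF A] by (metis vec_carrier)
    then have "x i = 0" if "i < n" for i using that by (metis index_vec index_zero_vec(1))
    then show "x = 0" using x by (auto simp: seq_space_def fun_eq_iff not_less) (metis not_less)
  qed
qed

lemma isometry_seq:
  assumes AG: "isometry_mat n A G"
  shows "quadratic_space.isometry seq_scale (seq_space n) (seq_form A n) (seq_map G n)"
proof -
  interpret quadratic_space seq_scale "seq_space n" "seq_form A n"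
    using AG by (rule quadratic_space_seq)
  have A: "A \<in> carrier_mat n n" and G: "G \<in> carrier_mat n n" and det0: "det A \<noteq> 0"
    and pres: "G\<^sup>T * A * G = A" using AG by (auto simp: isometry_mat_def)
  have "det (G\<^sup>T * A * G) = det (G\<^sup>T * A) * det G" using A G by (intro det_mult[of _ n]) auto
  then have G0: "det G \<noteq> 0" using det0 pres by auto
  define H where "H = (1 / det G) \<cdot>\<^sub>m adj_mat G"
  have H: "H \<in> carrier_mat n n" using adj_mat(1)[OF G] by (simp add: H_def)
  have unit: "(1 / det G) \<cdot>\<^sub>m (det G \<cdot>\<^sub>m 1\<^sub>m n) = 1\<^sub>m n"
    using G0 by (intro eq_matI) auto
  have GH: "G * H = 1\<^sub>m n" and HG: "H * G = 1\<^sub>m n"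
    using adj_mat[OF G] G
    by (simp_all add: H_def mult_smult_distrib[of _ n n _ n] mult_smult_assoc_mat[of _ n n _ n] unit)
  have inv: "seq_map X n (seq_map Y n x) = x"
    if X: "X \<in> carrier_mat n n" and Y: "Y \<in> carrier_mat n n" and XY: "X * Y = 1\<^sub>m n"
      and x: "x \<in> seq_space n" for X Y :: "'a mat" and x
  proof
    fix i
    have "X *\<^sub>v (Y *\<^sub>v vec n x) = vec n x"
      using X Y XY by (simp add: assoc_mult_mat_vec[symmetric])
    then show "seq_map X n (seq_map Y n x) i = x i"
      using x vec_seq_map[OF Y] by (auto simp: seq_map_def[of X] seq_space_def)
  qed
  have mem: "seq_map X n x \<in> seq_space n" for X :: "'a mat" and x
    by (simp add: seq_map_def seq_space_def)
  have "bij_betw (seq_map G n) (seq_space n) (seq_space n)"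
    by (rule bij_betw_byWitness[of _ "seq_map H n"])
      (use inv[OF G H GH] inv[OF H G HG] mem in auto)
  moreover have "seq_map G n (x + y) = seq_map G n x + seq_map G n y" for x y
    using G by (auto simp: seq_map_def fun_eq_iff mult_add_distrib_mat_vec[of _ n n])
  moreover have "seq_map G n (seq_scale c x) = seq_scale c (seq_map G n x)" for c x
  proof
    fix i show "seq_map G n (seq_scale c x) i = seq_scale c (seq_map G n x) i"
      using G unfolding seq_map_def vec_seq
      by (simp add: mult_mat_vec[of _ n n] seq_scale_def)
  qed
  moreover have "seq_form A n (seq_map G n x) (seq_map G n y) = seq_form A n x y" for x y
  proof -
    have "(G\<^sup>T * A * G) *\<^sub>v vec n y = G\<^sup>T *\<^sub>v (A *\<^sub>v (G *\<^sub>v vec n y))"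
      using A G by (simp add: assoc_mult_mat_vec[of _ n n _ n])
    then have "seq_form A n x y = vec n x \<bullet> (G\<^sup>T *\<^sub>v (A *\<^sub>v (G *\<^sub>v vec n y)))"
      by (simp add: seq_form_def pres)
    also have "\<dots> = (G\<^sup>T *\<^sub>v (A *\<^sub>v (G *\<^sub>v vec n y))) \<bullet> vec n x"
      using A G by (intro comm_scalar_prod[of _ n]) auto
    also have "\<dots> = (A *\<^sub>v (G *\<^sub>v vec n y)) \<bullet> (G *\<^sub>v vec n x)"
      using A G by (intro transpose_vec_mult_scalar[of _ n n]) auto
    also have "\<dots> = seq_form A n (seq_map G n x) (seq_map G n y)"
      using A G unfolding seq_form_def vec_seq_map[OF G] by (intro comm_scalar_prod[of _ n]) auto
    finally show ?thesis ..
  qed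
  ultimately show ?thesis unfolding isometry_def by blast
qed

lemma ordered_basis_seq:
  assumes AG: "isometry_mat n (A :: 'k::field mat) G"
  shows "quadratic_space.ordered_basis seq_scale (seq_space n :: (nat \<Rightarrow> 'k) set) (map seq_unit [0..<n])"
proof -
  interpret quadratic_space seq_scale "seq_space n" "seq_form A n"
    using AG by (rule quadratic_space_seq)
  have "set (map seq_unit [0..<n]) = (seq_unit ` {..<n} :: (nat \<Rightarrow> 'k) set)"
    by (simp add: atLeast0LessThan)
  then show ?thesis
    using independent_seq_unit[of n] span_seq_unit[of n] inj_seq_unit
    unfolding ordered_basis_def by (simp add: distinct_map inj_on_subset[OF inj_seq_unit])
qed

lemma dim_seq_space:
  assumes AG: "isometry_mat n (A :: 'k::field mat) G"
  shows "seq.dim (seq_space n :: (nat \<Rightarrow> 'k) set) = n"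
proof -
  interpret quadratic_space seq_scale "seq_space n" "seq_form A n"
    using AG by (rule quadratic_space_seq)
  show ?thesis using dim_eq_length_basis[OF ordered_basis_seq[OF AG]] by simp
qed

lemma characteristic_poly_seq:
  assumes AG: "isometry_mat n (A :: 'k::field mat) G"
  shows "quadratic_space.characteristic_poly seq_scale (seq_space n) (seq_map G n) = char_poly G"
proof -
  interpret quadratic_space seq_scale "seq_space n" "seq_form A n"
    using AG by (rule quadratic_space_seq)
  note bs = ordered_basis_seq[OF AG]
  note iso = isometryD[OF isometry_seq[OF AG]]
  have G: "G \<in> carrier_mat n n" using AG by (simp add: isometry_mat_def)
  have "matrix_wrt (map seq_unit [0..<n]) (seq_map G n) = G"
  proof (rule matrix_wrt_eqI[OF bs])
    show "G \<in> carrier_mat (length (map seq_unit [0..<n])) (length (map seq_unit [0..<n]))"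
      using G by simp
    fix j assume "j < length (map seq_unit [0..<n])"
    then have j: "j < n" by simp
    have col: "seq_map G n (seq_unit j) i = G $$ (i,j)" if "i < n" for i
    proof -
      have "seq_map G n (seq_unit j) i = (\<Sum>k<n. G $$ (i,k) * seq_unit j k)"
        using that G by (simp add: seq_map_def scalar_prod_def atLeast0LessThan)
      also have "\<dots> = (\<Sum>k<n. if k = j then G $$ (i,k) else 0)"
        by (intro sum.cong) (auto simp: seq_unit_def)
      finally have "seq_map G n (seq_unit j) i = (\<Sum>k<n. if k = j then G $$ (i,k) else 0)" .
      then show ?thesis using j by simp
    qed
    have "seq_map G n (seq_unit j) = (\<Sum>i<n. seq_scale (seq_map G n (seq_unit j) i) (seq_unit i))"
      by (rule seq_space_expansion) (simp add: seq_map_def seq_space_def)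
    also have "\<dots> = (\<Sum>i<n. seq_scale (G $$ (i,j)) (seq_unit i))"
      by (intro sum.cong) (auto simp: col)
    finally show "seq_map G n (map seq_unit [0..<n] ! j)
        = (\<Sum>i<length (map seq_unit [0..<n]). seq_scale (G $$ (i,j)) (map seq_unit [0..<n] ! i))"
      using j by simp
  qed
  then show ?thesis using characteristic_poly_eq[OF bs iso(1-3)] by simp
qed

text \<open>
  The isometry of the sum is the reflection in the new basis vector, of norm \<open>a\<close>, times the extension
  of the old isometry by the identity. The vectors of a factorization of the old isometry have
  last coordinate zero, so their reflections for the new form extend the old ones.
\<close>

lemma spinor_norm_orthogonal_sum_minus_one:
  fixes A G :: "'k::field mat"
  assumes two: "(2::'k) \<noteq> 0" and AG: "isometry_mat n A G" and a: "a \<noteq> 0"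
    and fac: "quadratic_space.reflection_factorization seq_scale (seq_space n) (seq_form A n) (seq_map G n) vs"
  defines "A' \<equiv> four_block_mat A (0\<^sub>m n 1) (0\<^sub>m 1 n) (mat 1 1 (\<lambda>_. a))"
    and "G' \<equiv> four_block_mat G (0\<^sub>m n 1) (0\<^sub>m 1 n) (mat 1 1 (\<lambda>_. - 1))"
  shows "quadratic_space.spinor_norm seq_scale (seq_space (Suc n)) (seq_form A' (Suc n)) (seq_map G' (Suc n))
    = square_class (a * (\<Prod>v\<leftarrow>vs. seq_form A n v v))"
proof -
  have AG': "isometry_mat (Suc n) A' G'"
    unfolding A'_def G'_def by (rule isometry_mat_extend(1)[OF AG a]) simp
  interpret Q: quadratic_space seq_scale "seq_space n" "seq_form A n"
    using AG by (rule quadratic_space_seq)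
  interpret Q': quadratic_space seq_scale "seq_space (Suc n)" "seq_form A' (Suc n)"
    using AG' by (rule quadratic_space_seq)
  have A: "A \<in> carrier_mat n n" and G: "G \<in> carrier_mat n n"
    and A': "A' \<in> carrier_mat (Suc n) (Suc n)" and G': "G' \<in> carrier_mat (Suc n) (Suc n)"
    using AG AG' by (auto simp: isometry_mat_def)
  have form: "seq_form A' (Suc n) x y = seq_form A n x y + a * x n * y n" for x y
  proof -
    have "A' $$ (i,j) = (if i < n \<and> j < n then A $$ (i,j) else if i = n \<and> j = n then a else 0)"
      if "i < Suc n" "j < Suc n" for i j
      using that A by (auto simp: A'_def)
    then show ?thesis using A A' by (simp add: seq_form_sum)
  qed
  have map: "seq_map G' (Suc n) x = seq_map G n x - seq_scale (x n) (seq_unit n)" for x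
  proof
    fix i
    have "G' $$ (i,j) = (if i < n \<and> j < n then G $$ (i,j) else if i = n \<and> j = n then - 1 else 0)"
      if "i < Suc n" "j < Suc n" for i j
      using that G by (auto simp: G'_def)
    then show "seq_map G' (Suc n) x i = (seq_map G n x - seq_scale (x n) (seq_unit n)) i"
      using G G' by (auto simp: seq_map_def scalar_prod_def atLeast0LessThan seq_unit_def seq_scale_def)
  qed
  have vs: "v \<in> seq_space n" "seq_form A n v v \<noteq> 0" if "v \<in> set vs" for v
    using fac that unfolding Q.reflection_factorization_iff by auto
  have last0: "v n = 0" if "v \<in> seq_space n" for v :: "nat \<Rightarrow> 'k"
    using that by (simp add: seq_space_def)
  have vs_last: "v n = 0" if "v \<in> set vs" for v using last0[OF vs(1)[OF that]] .
  have prod: "Q'.reflection_product us (z + seq_scale c (seq_unit n))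
      = Q.reflection_product us z + seq_scale c (seq_unit n)"
    if "set us \<subseteq> set vs" for us z c
    using that
  proof (induction us)
    case (Cons u us)
    have u: "u n = 0" using Cons.prems vs last0 by simp
    have form_shift: "seq_form A n (y + seq_scale c (seq_unit n)) u = seq_form A n y u" for y
      using A by (simp add: seq_form_sum seq_scale_def seq_unit_def)
    have "Q.reflection u (y + seq_scale c (seq_unit n)) = Q.reflection u y + seq_scale c (seq_unit n)" for y
      by (simp only: Q.reflection_def form_shift diff_add_eq)
    moreover have "Q'.reflection u y = Q.reflection u y" for y
      unfolding Q.reflection_def Q'.reflection_def using u by (simp add: form)
    moreover have "Q'.reflection_product us (z + seq_scale c (seq_unit n))
        = Q.reflection_product us z + seq_scale c (seq_unit n)"
      by (rule Cons.IH) (use Cons.prems in simp)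
    ultimately show ?case
      by (simp only: Q.reflection_product_simps Q'.reflection_product_simps)
  qed simp
  have "Q'.reflection_factorization (seq_map G' (Suc n)) (seq_unit n # vs)"
    unfolding Q'.reflection_factorization_iff
  proof (intro conjI ballI)
    fix v assume "v \<in> set (seq_unit n # vs)"
    moreover have "seq_form A n (seq_unit n) (seq_unit n) = 0"
      using A by (simp add: seq_form_sum seq_unit_def)
    ultimately show "v \<in> seq_space (Suc n)" "seq_form A' (Suc n) v v \<noteq> 0"
      using vs a by (auto simp: form vs_last seq_space_def seq_unit_def)
  next
    fix x :: "nat \<Rightarrow> 'k" assume x: "x \<in> seq_space (Suc n)"
    define z where "z = x(n := 0)"
    have z: "z \<in> seq_space n" using x by (auto simp: z_def seq_space_def)
    have x_eq: "x = z + seq_scale (x n) (seq_unit n)"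
      by (auto simp: z_def seq_scale_def seq_unit_def)
    have "Q'.reflection_product vs x = seq_map G n z + seq_scale (x n) (seq_unit n)"
      using prod[of vs z "x n"] fac z unfolding x_eq[symmetric] Q.reflection_factorization_iff by simp
    also have "seq_map G n z = seq_map G n x"
      using G by (auto simp: seq_map_def z_def scalar_prod_def intro!: sum.cong)
    finally have y: "Q'.reflection_product vs x = seq_map G n x + seq_scale (x n) (seq_unit n)" .
    have "seq_form A n y (seq_unit n) = 0" for y
      using A by (simp add: seq_form_sum seq_unit_def)
    then have refl: "Q'.reflection (seq_unit n) y = y - seq_scale (2 * y n) (seq_unit n)" for y
      unfolding Q'.reflection_def using a by (simp add: form seq_unit_def)
    have "Q'.reflection_product (seq_unit n # vs) x
        = Q'.reflection (seq_unit n) (seq_map G n x + seq_scale (x n) (seq_unit n))"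
      by (simp only: Q'.reflection_product_simps y)
    also have "\<dots> = seq_map G n x - seq_scale (x n) (seq_unit n)"
      unfolding refl by (rule ext) (simp add: seq_map_def seq_scale_def seq_unit_def)
    also have "\<dots> = seq_map G' (Suc n) x" by (rule map[symmetric])
    finally have "Q'.reflection_product (seq_unit n # vs) x = seq_map G' (Suc n) x" .
    then show "seq_map G' (Suc n) x = Q'.reflection_product (seq_unit n # vs) x" ..
  qed
  from Q'.spinor_norm_eq[OF two this]
  have "Q'.spinor_norm (seq_map G' (Suc n))
      = square_class (seq_form A' (Suc n) (seq_unit n) (seq_unit n) * (\<Prod>v\<leftarrow>vs. seq_form A' (Suc n) v v))"
    by simp
  also have "seq_form A' (Suc n) (seq_unit n) (seq_unit n) = a"
    using A by (simp add: form seq_form_sum seq_unit_def)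
  also have "map (\<lambda>v. seq_form A' (Suc n) v v) vs = map (\<lambda>v. seq_form A n v v) vs"
    using vs last0 by (auto simp: form)
  finally show ?thesis .
qed

text \<open>
  Removing one factor \<open>T + 1\<close> leaves a polynomial realized by an isometry of some spinor norm \<open>s\<close>;
  a line with isometry \<open>-1\<close> and norm \<open>c / s\<close> restores the factor and adjusts the class to that of \<open>c\<close>.
\<close>

lemma isometry_with_spinor_norm_exists:
  fixes p :: "'k::field poly"
  assumes two: "(2::'k) \<noteq> 0" and "monic p" and "reciprocal p" and "even (degree p)"
    and roots: "poly p 1 \<noteq> 0" "poly p (- 1) \<noteq> 0" and C: "C \<in> square_classes"
  shows "\<exists>(V :: (nat \<Rightarrow> 'k) set) \<Psi> \<gamma>.
        nondegenerate_quadratic_space seq_scale V \<Psi>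
        \<and> vector_space.dim seq_scale V = Suc (a + b + degree p)
        \<and> quadratic_space.isometry seq_scale V \<Psi> \<gamma>
        \<and> quadratic_space.characteristic_poly seq_scale V \<gamma> = [:- 1, 1:] ^ a * [:1, 1:] ^ Suc b * p
        \<and> quadratic_space.spinor_norm seq_scale V \<Psi> \<gamma> = C"
proof -
  let ?n = "a + b + degree p"
  obtain A G where AG: "isometry_mat ?n A G"
    and cp: "char_poly G = [:- 1, 1:] ^ a * [:1, 1:] ^ b * p"
    using isometry_mat_exists[OF assms(2-6)] by blast
  interpret Q: nondegenerate_quadratic_space seq_scale "seq_space ?n" "seq_form A ?n"
    using AG by (rule nondegenerate_seq)
  obtain vs where vs: "Q.reflection_factorization (seq_map G ?n) vs"
    using seq.Cartan_Dieudonne[OF two nondegenerate_seq[OF AG] isometry_seq[OF AG]] by blast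
  define s where "s = (\<Prod>v\<leftarrow>vs. seq_form A ?n v v)"
  have "s \<noteq> 0"
    using vs unfolding Q.reflection_factorization_iff s_def by (auto simp: prod_list_zero_iff)
  obtain c where c: "c \<noteq> 0" "C = square_class c" using C by (auto simp: square_classes_def)
  define A' where "A' = four_block_mat A (0\<^sub>m ?n 1) (0\<^sub>m 1 ?n) (mat 1 1 (\<lambda>_. c / s))"
  define G' where "G' = four_block_mat G (0\<^sub>m ?n 1) (0\<^sub>m 1 ?n) (mat 1 1 (\<lambda>_. - 1))"
  have cs: "c / s \<noteq> 0" using c \<open>s \<noteq> 0\<close> by simp
  have AG': "isometry_mat (Suc ?n) A' G'" and cp': "char_poly G' = char_poly G * [:- (- 1), 1:]"
    unfolding A'_def G'_def by (rule isometry_mat_extend[OF AG cs]; simp)+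
  have "quadratic_space.spinor_norm seq_scale (seq_space (Suc ?n)) (seq_form A' (Suc ?n))
      (seq_map G' (Suc ?n)) = square_class (c / s * s)"
    unfolding A'_def G'_def s_def
    by (rule spinor_norm_orthogonal_sum_minus_one[OF two AG _ vs]) (use cs in \<open>simp add: s_def\<close>)
  then have "quadratic_space.spinor_norm seq_scale (seq_space (Suc ?n)) (seq_form A' (Suc ?n))
      (seq_map G' (Suc ?n)) = C"
    using \<open>s \<noteq> 0\<close> c by simp
  moreover have "char_poly G' = [:- 1, 1:] ^ a * [:1, 1:] ^ Suc b * p"
    by (simp only: cp' cp minus_minus power_Suc ac_simps)
  ultimately show ?thesis
    using nondegenerate_seq[OF AG'] dim_seq_space[OF AG'] isometry_seq[OF AG']
      characteristic_poly_seq[OF AG'] by metis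
qed

section \<open>The spinor norms attached to a reciprocal polynomial\<close>

text \<open>
  In even dimension \<open>n\<close> the value of the characteristic polynomial at \<open>-1\<close> is \<open>det (1 + f)\<close>, and \<open>2^n\<close> is
  a square.
\<close>

lemma (in nondegenerate_quadratic_space) spinor_norm_eq_characteristic_poly_minus_one:
  assumes two: "(2::'a) \<noteq> 0" and iso: "isometry f" and cp: "characteristic_poly f = p"
    and even: "even (degree p)" and root: "poly p (- 1) \<noteq> 0"
  shows "spinor_norm f = square_class (poly p (- 1))"
proof -
  obtain bs where bs: "ordered_basis bs" using ordered_basis_exists by blast
  let ?n = "length bs" and ?M = "matrix_wrt bs f"
  have M: "?M \<in> carrier_mat ?n ?n" by (rule matrix_wrt_carrier)
  have p: "p = char_poly ?M"
    using characteristic_poly_eq[OF bs isometryD(1-3)[OF iso]] cp by simp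
  then have n: "even ?n" using even degree_monic_char_poly[OF M] by simp
  then have D: "poly p (- 1) = det (1\<^sub>m ?n + ?M)"
    unfolding p poly_char_poly_minus_one[OF M] by simp
  obtain vs where vs: "reflection_factorization f vs"
    using Cartan_Dieudonne[OF two nondegenerate_quadratic_space_axioms iso] by blast
  obtain r where r: "?n = 2 * r" using n by blast
  have "spinor_norm f = square_class (2 ^ ?n * poly p (- 1))"
    using spinor_norm_eq[OF two vs] spinor_product_det[OF two bs vs] root by (simp add: D)
  also have "\<dots> = square_class (poly p (- 1))"
  proof (rule square_class_eqI)
    show "2 ^ ?n * poly p (- 1) = poly p (- 1) * (2 ^ r)\<^sup>2"
      by (simp add: r power_mult[symmetric] mult.commute)
  qed (use two in simp)
  finally show ?thesis .
qed

text \<open>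
  Reflection is multiplicative, fixes \<open>T + 1\<close> and changes the sign of \<open>T - 1\<close>. So the reflection
  of \<open>p\<close> is \<open>(-1)^a p\<close>; at \<open>1\<close> a polynomial and its reflection agree, whence \<open>a\<close> is even, and at \<open>-1\<close>
  they differ by the sign \<open>(-1)^(degree p)\<close>, whence the degree is even.
\<close>

lemma reciprocal_cofactor:
  fixes q p :: "'k::field poly"
  assumes two: "(2::'k) \<noteq> 0" and monic: "monic q" and rec: "reciprocal q"
    and q: "q = [:- 1, 1:] ^ a * [:1, 1:] ^ b * p"
    and roots: "poly p 1 \<noteq> 0" "poly p (- 1) \<noteq> 0"
  shows "monic p" and "reciprocal p" and "even (degree p)" and "even a"
    and "degree q = a + b + degree p"
proof -
  let ?m = "[:- 1, 1:] :: 'k poly" and ?s = "[:1, 1:] :: 'k poly"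
  have p0: "p \<noteq> 0" using roots by auto
  have one: "lead_coeff ?m = 1" "lead_coeff ?s = 1" by simp_all
  show "monic p" using monic unfolding q lead_coeff_mult lead_coeff_power one by simp
  show "degree q = a + b + degree p"
    using p0 unfolding q by (simp add: degree_mult_eq degree_power_eq del: mult_pCons_left mult_pCons_right)
  have refl: "reflect_poly ?m = - ?m" "reflect_poly ?s = ?s"
    by (simp_all add: reflect_poly_pCons)
  have "?m ^ a * ?s ^ b * p = (- ?m) ^ a * ?s ^ b * reflect_poly p"
    using rec unfolding reciprocal_def q reflect_poly_mult reflect_poly_power refl by simp
  also have "\<dots> = ?m ^ a * ?s ^ b * ((- 1) ^ a * reflect_poly p)"
    by (simp only: power_minus[of ?m] ac_simps)
  finally have p_eq: "p = (- 1) ^ a * reflect_poly p"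
    by (metis mult_left_cancel mult_eq_0_iff p0 pCons_eq_0_iff power_not_zero zero_neq_one)
  have "poly p 1 = (- 1) ^ a * poly p 1"
    using arg_cong[OF p_eq, of "\<lambda>p. poly p 1"] by (simp add: poly_reflect_poly_nz)
  then show "even a" using roots by (intro even_if_neg_one_power_eq_one[OF two]) simp
  then have p_refl: "reflect_poly p = p" using p_eq by simp
  then show "reciprocal p" by (simp add: reciprocal_def)
  have "poly p (- 1) = (- 1) ^ degree p * poly p (- 1)"
    using poly_reflect_poly_nz[of "- 1" p] by (simp add: p_refl)
  then show "even (degree p)" using roots by (intro even_if_neg_one_power_eq_one[OF two]) simp
qed

lemma separable_no_square_factor:
  fixes q f g :: "'k::field poly"
  assumes "separable_poly q" and "q = f ^ 2 * g"
  shows "is_unit f"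
proof -
  have "f dvd q" using assms(2) by (simp add: power2_eq_square)
  moreover have "pderiv q = f * (2 * pderiv f * g + f * pderiv g)"
    by (simp add: assms(2) power2_eq_square pderiv_mult algebra_simps)
  then have "f dvd pderiv q" by simp
  ultimately show ?thesis
    using assms(1) unfolding separable_poly_def by (rule coprime_common_divisor[rotated])
qed

theorem corollary5p3:
  fixes q Q0 :: "'k::field poly"
    and vp vm d :: nat
    and scale :: "'k \<Rightarrow> 'v::ab_group_add \<Rightarrow> 'v"
  assumes char_k: "CHAR('k) \<noteq> 2"
    and q_monic: "monic q"
    and q_reciprocal: "reciprocal q"
    and q_degree: "degree q = d" "d \<ge> 1"
    and q_factors: "q = [:- 1, 1:] ^ vp * [:1, 1:] ^ vm * Q0"
    and Q0_nonzero: "poly Q0 1 \<noteq> 0" "poly Q0 (- 1) \<noteq> 0"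
  shows
    "(vm > 0 \<longrightarrow>
      (\<forall>C \<in> square_classes. \<exists>(V :: (nat \<Rightarrow> 'k) set) \<Psi> \<gamma>.
        nondegenerate_quadratic_space seq_scale V \<Psi>
        \<and> vector_space.dim seq_scale V = d
        \<and> quadratic_space.isometry seq_scale V \<Psi> \<gamma>
        \<and> quadratic_space.characteristic_poly seq_scale V \<gamma> = q
        \<and> quadratic_space.spinor_norm seq_scale V \<Psi> \<gamma> = C))
    \<and> (odd d \<longrightarrow> vm > 0 \<and>
      (\<forall>C \<in> square_classes. \<exists>(V :: (nat \<Rightarrow> 'k) set) \<Psi> \<gamma>.
        nondegenerate_quadratic_space seq_scale V \<Psi>
        \<and> vector_space.dim seq_scale V = d
        \<and> quadratic_space.isometry seq_scale V \<Psi> \<gamma>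
        \<and> quadratic_space.characteristic_poly seq_scale V \<gamma> = q
        \<and> quadratic_space.spinor_norm seq_scale V \<Psi> \<gamma> = C))
    \<and> (vm = 0 \<longrightarrow>
      (\<forall>V \<Psi> \<gamma>. nondegenerate_quadratic_space scale V \<Psi>
        \<and> quadratic_space.isometry scale V \<Psi> \<gamma>
        \<and> quadratic_space.characteristic_poly scale V \<gamma> = q
        \<longrightarrow> quadratic_space.spinor_norm scale V \<Psi> \<gamma> = square_class (poly Q0 (- 1))))
    \<and> (separable_poly q \<and> even d \<longrightarrow> vm = 0 \<and>
      (\<forall>V \<Psi> \<gamma>. nondegenerate_quadratic_space scale V \<Psi>
        \<and> quadratic_space.isometry scale V \<Psi> \<gamma>
        \<and> quadratic_space.characteristic_poly scale V \<gamma> = q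
        \<longrightarrow> quadratic_space.spinor_norm scale V \<Psi> \<gamma> = square_class (poly Q0 (- 1))))"
proof -
  have two: "(2::'k) \<noteq> 0"
  proof
    assume "(2::'k) = 0"
    then have "of_nat 2 = (0::'k)" by simp
    then have "CHAR('k) dvd 2" by (simp only: of_nat_eq_0_iff_char_dvd)
    then have "CHAR('k) = 1 \<or> CHAR('k) = 2"
      by (metis prime_nat_iff two_is_prime_nat)
    then show False using char_k by simp
  qed
  note Q0 = reciprocal_cofactor[OF two q_monic q_reciprocal q_factors Q0_nonzero]
  have d: "d = vp + vm + degree Q0" using Q0(5) q_degree by simp
  have existence: "\<forall>C \<in> square_classes. \<exists>(V :: (nat \<Rightarrow> 'k) set) \<Psi> \<gamma>.
        nondegenerate_quadratic_space seq_scale V \<Psi>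
        \<and> vector_space.dim seq_scale V = d
        \<and> quadratic_space.isometry seq_scale V \<Psi> \<gamma>
        \<and> quadratic_space.characteristic_poly seq_scale V \<gamma> = q
        \<and> quadratic_space.spinor_norm seq_scale V \<Psi> \<gamma> = C" if pos: "vm > 0"
  proof -
    obtain b where b: "vm = Suc b" using pos by (cases vm) auto
    have "d = Suc (vp + b + degree Q0)" using d b by simp
    then show ?thesis
      using isometry_with_spinor_norm_exists[OF two Q0(1-3) Q0_nonzero, of _ vp b]
      unfolding q_factors b by blast
  qed
  have formula: "\<forall>V \<Psi> \<gamma>. nondegenerate_quadratic_space scale V \<Psi>
        \<and> quadratic_space.isometry scale V \<Psi> \<gamma>
        \<and> quadratic_space.characteristic_poly scale V \<gamma> = q
        \<longrightarrow> quadratic_space.spinor_norm scale V \<Psi> \<gamma> = square_class (poly Q0 (- 1))" if vm0: "vm = 0"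
  proof (intro allI impI, elim conjE)
    fix V \<Psi> \<gamma>
    assume nondeg: "nondegenerate_quadratic_space scale V \<Psi>"
      and iso: "quadratic_space.isometry scale V \<Psi> \<gamma>"
      and cp: "quadratic_space.characteristic_poly scale V \<gamma> = q"
    obtain r where r: "vp = 2 * r" using Q0(4) by blast
    \<comment> \<open>the factor \<open>(-2)^(v\<^sub>+)\<close> is a square since \<open>v\<^sub>+\<close> is even\<close>
    have val: "poly q (- 1) = poly Q0 (- 1) * ((- 2) ^ r)\<^sup>2"
      by (simp add: q_factors vm0 r power_mult power_mult_distrib mult.commute power2_eq_square)
    have pow: "(- 2 :: 'k) ^ r \<noteq> 0" using two by simp
    have "even (degree q)" using Q0(3,4) d q_degree vm0 by simp
    moreover have "poly q (- 1) \<noteq> 0" using val pow Q0_nonzero by simp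
    ultimately have "quadratic_space.spinor_norm scale V \<Psi> \<gamma> = square_class (poly q (- 1))"
      by (rule nondegenerate_quadratic_space.spinor_norm_eq_characteristic_poly_minus_one
          [OF nondeg two iso cp])
    also have "\<dots> = square_class (poly Q0 (- 1))" by (rule square_class_eqI[OF val pow])
    finally show "quadratic_space.spinor_norm scale V \<Psi> \<gamma> = square_class (poly Q0 (- 1))" .
  qed
  have odd: "vm > 0" if "odd d" using that d Q0(3,4) by (cases "vm = 0") auto
  have separable: "vm = 0" if sep: "separable_poly q" and ev: "even d"
  proof (rule ccontr)
    assume "vm \<noteq> 0"
    moreover have "even vm" using ev d Q0(3,4) by simp
    ultimately obtain b where b: "vm = b + 2"
      by (metis add.commute even_Suc le_add_diff_inverse less_2_cases_iff not_less odd_one One_nat_def)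
    have "q = [:1, 1:] ^ 2 * ([:- 1, 1:] ^ vp * [:1, 1:] ^ b * Q0)"
      unfolding q_factors b power_add by (simp only: ac_simps)
    then have "is_unit ([:1, 1:] :: 'k poly)" by (rule separable_no_square_factor[OF sep])
    then show False by (simp add: is_unit_pCons_iff)
  qed
  show ?thesis
    by (intro conjI impI; (elim conjE)?; (assumption | rule existence formula odd separable)+)
qed

end
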